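(* Let $N\ge1$ be an integer, ${\mathcal X}\in\mathbb{R}$ with $C_{{\mathcal X}}$ (defined below) finite, $\theta\in(0,\pi)$, and $c>0$. With $R_1^{T_{{\mathcal X}}}$ and $C_{{\mathcal X}}$ as defined in the context, $$R_1^{T_{{\mathcal X}}}(\theta)=\frac{C_{{\mathcal X}}}{2\pi i}\int_{c-i\infty}^{c+i\infty}\frac{\exp(-r{\mathcal X})}{r}\,2^{N^2+2Nr-N}\prod_{j=0}^{N-1}\frac{\Gamma(2+j)\Gamma(1/2+j)\Gamma(r+1/2+j)}{\Gamma(r+N+j)}\,(1-\cos\theta)^r\,\frac{2^{1-r}}{2N+r-1}\,\frac{\Gamma(N+1)\Gamma(N+r)}{\Gamma(N+r-1/2)\Gamma(N-1/2)}\,P(N,r,\theta)\,dr,$$ where $$P(N,r,\theta)=\Big[\tfrac{d}{dx}P_N^{(r-1/2,-1/2)}(x)\Big]_{x=\cos\theta}P_{N-1}^{(r-1/2,-1/2)}(\cos\theta)-P_N^{(r-1/2,-1/2)}(\cos\theta)\Big[\tfrac{d}{dx}P_{N-1}^{(r-1/2,-1/2)}(x)\Big]_{x=\cos\theta}.$$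
   Context: For $A\in\mathrm{SO}(2N)$ with eigenvalues $e^{\pm i\theta_1},\dots,e^{\pm i\theta_N}$, $\theta_j\in[0,\pi]$, set $\Lambda_A(1,N)=\det(I-A^{-1})=2^N\prod_{j=1}^N(1-\cos\theta_j)$. Let $H$ be the Heaviside function. The normalization constant $C_{{\mathcal X}}$ is defined by $1=C_{{\mathcal X}}\int_{[0,\pi]^N}H(\log\Lambda_A(1,N)-{\mathcal X})\prod_{j<k}(\cos\theta_j-\cos\theta_k)^2\,d\theta_1\cdots d\theta_N$, and the one-level density of the excised ensemble $T_{{\mathcal X}}=\{A\in\mathrm{SO}(2N):\log|\Lambda_A(1,N)|\ge{\mathcal X}\}$ is $R_1^{T_{{\mathcal X}}}(\theta_1)=C_{{\mathcal X}}N\int_{[0,\pi]^{N-1}}H(\log|\Lambda_A(1,N)|-{\mathcal X})\prod_{j<k}(\cos\theta_j-\cos\theta_k)^2\,d\theta_2\cdots d\theta_N.$ $P_n^{(\alpha,\beta)}$ denotes the Jacobi polynomial of degree $n$ in Szegő's normalization: $P_n^{(\alpha,\beta)}(x)=\binom{n+\alpha}{n}F(-n,n+\alpha+\beta+1;\alpha+1;\tfrac{1-x}{2})$ with $F$ the Gauss hypergeometric function; these satisfy $\int_{-1}^1P_nP_m(1-x)^\alpha(1+x)^\beta dx=\delta_{nm}\frac{2^{\alpha+\beta+1}}{2n+\alpha+\beta+1}\frac{\Gamma(n+\alpha+1)\Gamma(n+\beta+1)}{\Gamma(n+1)\Gamma(n+\alpha+\beta+1)}$, and are polynomials in $\alpha,\beta,x$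 for complex $\alpha,\beta$. The contour is the vertical line $\mathrm{Re}(r)=c$. *)

theory Defs
  imports "HOL-Complex_Analysis.Complex_Analysis"
begin

section \<open>The excised orthogonal ensemble\<close>

text \<open>
  The value at the jump is the mean of the one-sided limits, as in Perron's formula:
  a symmetric (principal value) Mellin inversion integral returns exactly this value.
\<close>
definition heaviside :: "real \<Rightarrow> real" where
  "heaviside x = (if x < 0 then 0 else if x = 0 then 1 / 2 else 1)"

text \<open>
  The eigenangles are a family \<open>\<theta>\<close> indexed by \<open>{1..N}\<close>; other indices are irrelevant.
  \<open>char_poly_at_one N \<theta>\<close> is $\det(I - A^{-1})$ for \<open>A\<close> in $\mathrm{SO}(2N)$ with
  eigenvalues $e^{\pm i\theta_j}$.
\<close>
definition char_poly_at_one :: "nat \<Rightarrow> (nat \<Rightarrow> real) \<Rightarrow> real" where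
  "char_poly_at_one N \<theta> = 2 ^ N * (\<Prod>j\<in>{1..N}. 1 - cos (\<theta> j))"

text \<open>
  \<open>H(log |\<Lambda>| - X)\<close> times the squared Vandermonde factor. The case distinction implements
  \<open>log 0 = -\<infinity>\<close>, since \<open>ln 0 = 0\<close> in the library.
\<close>
definition excised_weight :: "nat \<Rightarrow> real \<Rightarrow> (nat \<Rightarrow> real) \<Rightarrow> real" where
  "excised_weight N X \<theta> =
     (if char_poly_at_one N \<theta> = 0 then 0
      else heaviside (ln \<bar>char_poly_at_one N \<theta>\<bar> - X)) *
     (\<Prod>k\<in>{1..N}. \<Prod>j\<in>{1..<k}. (cos (\<theta> j) - cos (\<theta> k))\<^sup>2)"

definition excised_mass :: "nat \<Rightarrow> real \<Rightarrow> real" where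
  "excised_mass N X =
     (LINT \<theta> : (\<Pi>\<^sub>E j\<in>{1..N}. {0..pi}) | (\<Pi>\<^sub>M j\<in>{1..N}. lborel). excised_weight N X \<theta>)"

text \<open>
  The solution \<open>C\<close> of \<open>1 = C * excised_mass N X\<close>. The mass is the integral of a bounded
  function over a bounded set, so \<open>C\<close> is finite precisely when \<open>excised_mass N X \<noteq> 0\<close>.
\<close>
definition excised_const :: "nat \<Rightarrow> real \<Rightarrow> real" where
  "excised_const N X = 1 / excised_mass N X"

definition one_level_density :: "nat \<Rightarrow> real \<Rightarrow> real \<Rightarrow> real" where
  "one_level_density N X t =
     excised_const N X * real N *
     (LINT \<theta> : (\<Pi>\<^sub>E j\<in>{2..N}. {0..pi}) | (\<Pi>\<^sub>M j\<in>{2..N}. lborel).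
        excised_weight N X (\<theta>(1 := t)))"


section \<open>Jacobi polynomials\<close>

text \<open>
  Szego's normalization. The parameter \<open>- of_nat n\<close> makes the Gauss hypergeometric series
  terminate, so it is a polynomial in \<open>x\<close>. For \<open>\<alpha>\<close> in \<open>{-n..-1}\<close> the right-hand
  side would have to be read as a limit in \<open>\<alpha>\<close>; such \<open>\<alpha>\<close> are not covered.
\<close>
definition jacobi_poly :: "nat \<Rightarrow> complex \<Rightarrow> complex \<Rightarrow> complex \<Rightarrow> complex" where
  "jacobi_poly n \<alpha> \<beta> x =
     ((of_nat n + \<alpha>) gchoose n) *
     eval_fps (fps_hypergeo [- of_nat n, of_nat n + \<alpha> + \<beta> + 1] [\<alpha> + 1] 1) ((1 - x) / 2)"

definition jacobi_wronskian :: "nat \<Rightarrow> complex \<Rightarrow> real \<Rightarrow> complex" where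
  "jacobi_wronskian N r \<theta> =
     (let x = complex_of_real (cos \<theta>);
          p = (\<lambda>n. jacobi_poly n (r - 1 / 2) (- 1 / 2))
      in deriv (p N) x * p (N - 1) x - p N x * deriv (p (N - 1)) x)"


section \<open>Integrals along vertical lines\<close>

text \<open>
  $\int_{c-i\infty}^{c+i\infty}$ is the limit of the integrals over the symmetric segments
  from \<open>c - iT\<close> to \<open>c + iT\<close>; it need not converge absolutely.
\<close>
definition has_vertical_integral :: "(complex \<Rightarrow> complex) \<Rightarrow> real \<Rightarrow> complex \<Rightarrow> bool" where
  "has_vertical_integral f c I \<longleftrightarrow>
     (\<forall>T>0. f contour_integrable_on linepath (Complex c (- T)) (Complex c T)) \<and>
     ((\<lambda>T. contour_integral (linepath (Complex c (- T)) (Complex c T)) f) \<longlongrightarrow> I) at_top"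

definition vertical_integrable :: "(complex \<Rightarrow> complex) \<Rightarrow> real \<Rightarrow> bool" where
  "vertical_integrable f c \<longleftrightarrow> (\<exists>I. has_vertical_integral f c I)"

definition vertical_integral :: "real \<Rightarrow> (complex \<Rightarrow> complex) \<Rightarrow> complex" where
  "vertical_integral c f = (THE I. has_vertical_integral f c I)"


section \<open>The integrand of the contour integral\<close>

definition density_integrand :: "nat \<Rightarrow> real \<Rightarrow> real \<Rightarrow> complex \<Rightarrow> complex" where
  "density_integrand N X \<theta> r =
     exp (- r * of_real X) / r *
     2 powr (of_nat (N\<^sup>2) + 2 * of_nat N * r - of_nat N) *
     (\<Prod>j\<in>{0..<N}. Gamma (2 + of_nat j) * Gamma (1 / 2 + of_nat j) * Gamma (r + 1 / 2 + of_nat j)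
                     / Gamma (r + of_nat N + of_nat j)) *
     complex_of_real (1 - cos \<theta>) powr r *
     (2 powr (1 - r) / (2 * of_nat N + r - 1)) *
     (Gamma (of_nat N + 1) * Gamma (of_nat N + r)
        / (Gamma (of_nat N + r - 1 / 2) * Gamma (of_nat N - 1 / 2))) *
     jacobi_wronskian N r \<theta>"

end

theory Submission
  imports Defs "HOL-Probability.Sinc_Integral" "Jordan_Normal_Form.Determinant"
begin

text \<open>
  By Perron's formula the Heaviside factor is a principal value integral of $e^{ry}/r$ over
  \<open>Re r = c\<close>, where \<open>y\<close> is the logarithm of the characteristic polynomial minus \<open>X\<close>. As \<open>y\<close> is
  bounded above, the truncated integrals are bounded uniformly, so Fubini and dominated convergence
  move the contour integral outside the integral over the eigenangles. What is left is the average
  of the \<open>r\<close>-th power of the characteristic polynomial against the squared Vandermonde determinant.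
  The weight $(1 - \cos t)^r$ is complex, but orthogonality is used only in its bilinear form:
  expanding the Vandermonde determinant in monic Jacobi polynomials turns the average into a
  Christoffel-Darboux kernel on the diagonal.
\<close>

section \<open>Orthogonal polynomials for a linear functional\<close>

text \<open>With \<open>x = cos t\<close>, \<open>dt\<close> becomes
  \<open>(1 - x)^(-1/2) (1 + x)^(-1/2) dx\<close> up to orientation, so
  \<open>(1 - cos t)^r dt\<close> is the Jacobi weight with parameters \<open>r - 1/2\<close> and
  \<open>-1/2\<close>. All integrals are nevertheless kept in \<open>t\<close>, where the integrand
  is continuous on the whole of \<open>[0, pi]\<close> as soon as \<open>Re r > 0\<close>. A complex
  weight offers no positivity, so norms might vanish. The general theory of orthogonal polynomials
  therefore takes non-zero norms as an assumption, and for the Jacobi weight they are exhibited as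
  quotients of Gamma values without zeros or poles for \<open>Re r > 0\<close>. All these quotients
  descend from a single family, the moments of \<open>1 - cos t\<close> with complex exponent, each
  found at its own exponent by a recurrence and a limit along integer shifts. For
  \<open>N = 1\<close> no angle is left to integrate, so the density is a pointwise value; at a jump
  the limit of the symmetric integrals must then agree with \<open>heaviside 0 = 1 / 2\<close>, and
  it does.\<close>

text \<open>Subtracting the top coefficient times \<open>e n\<close> lowers the bound by one, so the
  monic \<open>e m\<close> with \<open>m < n\<close> generate everything of degree below
  \<open>n\<close>. The bound is put on coefficients rather than on \<open>degree\<close> because it
  then makes sense at \<open>n = 0\<close>, where it leaves only the zero polynomial. It is applied
  to the orthogonal polynomials and to the powers of \<open>1 + x\<close>.\<close>

lemma coeff_bound_monic_induct:
  fixes e :: "nat \<Rightarrow> 'a::field poly"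
  assumes monic: "\<And>m. m < n \<Longrightarrow> degree (e m) = m \<and> coeff (e m) m = 1"
    and q: "\<And>i. i \<ge> n \<Longrightarrow> coeff q i = 0"
    and zero: "P 0"
    and step: "\<And>c m q. m < n \<Longrightarrow> P q \<Longrightarrow> P (Polynomial.smult c (e m) + q)"
  shows "P q"
  using assms
proof (induction n arbitrary: q)
  case 0
  then have "q = 0" by (simp add: poly_eq_iff)
  with 0 show ?case by simp
next
  case (Suc n)
  define q' where "q' = q - Polynomial.smult (coeff q n) (e n)"
  have "P q'"
  proof (rule Suc.IH)
    fix i assume "i \<ge> n"
    then show "coeff q' i = 0"
      using Suc.prems(1)[of n] Suc.prems(2)[of i]
      by (cases "i = n") (auto simp: q'_def coeff_eq_0)
  qed (use Suc.prems in auto)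
  then have "P (Polynomial.smult (coeff q n) (e n) + q')"
    using Suc.prems by blast
  then show ?case by (simp add: q'_def)
qed

text \<open>\<open>L\<close> is only linear, and the pairing \<open>L (q * q')\<close> is bilinear
  without conjugation. Non-vanishing of the norms takes the place of positive definiteness.\<close>

locale monic_orthogonal =
  fixes L :: "'a::field_char_0 poly \<Rightarrow> 'a" and p :: "nat \<Rightarrow> 'a poly" and h :: "nat \<Rightarrow> 'a"
  assumes L_add: "L (q + q') = L q + L q'"
    and L_smult: "L (Polynomial.smult c q) = c * L q"
    and degree_p: "degree (p n) = n"
    and lead_p: "coeff (p n) n = 1"
    and orth: "m \<noteq> n \<Longrightarrow> L (p m * p n) = 0"
    and norm_p: "L (p n * p n) = h n"
    and norm_nz: "h n \<noteq> 0"
begin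

lemma L_zero: "L 0 = 0"
  using L_smult[of 0 0] by simp

lemma L_diff: "L (q - q') = L q - L q'"
  using L_add[of "q - q'" q'] by simp

lemma L_p_mult_lower_degree:
  assumes "\<And>i. i \<ge> n \<Longrightarrow> coeff q i = 0"
  shows "L (p n * q) = 0"
proof -
  have mon: "\<And>m. m < n \<Longrightarrow> degree (p m) = m \<and> coeff (p m) m = 1"
    by (simp add: degree_p lead_p)
  show ?thesis
  proof (rule coeff_bound_monic_induct[where e = p, OF mon assms])
    fix c m q assume "m < n" "L (p n * q) = 0"
    then show "L (p n * (Polynomial.smult c (p m) + q)) = 0"
      using orth[of n m] by (simp add: distrib_left L_add L_smult)
  qed (simp_all add: L_zero)
qed

text \<open>Pairing with the highest \<open>p n\<close> isolates the top coefficient times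
  \<open>h n\<close>, since the rest has lower degree; as \<open>h n\<close> is non-zero, the
  coefficient vanishes and the degree bound drops.\<close>

lemma eq_0_if_orthogonal:
  assumes "\<And>i. i \<ge> n \<Longrightarrow> coeff q i = 0" and "\<And>m. m < n \<Longrightarrow> L (p m * q) = 0"
  shows "q = 0"
  using assms
proof (induction n)
  case 0
  then show ?case by (simp add: poly_eq_iff)
next
  case (Suc n)
  have "L (p n * (q - Polynomial.smult (coeff q n) (p n))) = 0"
  proof (rule L_p_mult_lower_degree)
    fix i assume "i \<ge> n"
    then show "coeff (q - Polynomial.smult (coeff q n) (p n)) i = 0"
      using Suc.prems(1)[of i] by (cases "i = n") (auto simp: lead_p degree_p coeff_eq_0)
  qed
  then have "coeff q n * h n = 0"
    using Suc.prems(2)[of n] by (simp add: right_diff_distrib L_diff L_smult norm_p)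
  then have "coeff q n = 0" using norm_nz by simp
  then have "coeff q i = 0" if "i \<ge> n" for i
    using Suc.prems(1)[of i] that by (cases "i = n") auto
  then show ?case using Suc by simp
qed

text \<open>The difference \<open>q\<close> of the two sides has degree at most
  \<open>n + 1\<close>, because the leading terms cancel, and it is orthogonal to
  \<open>p 0\<close>, ..., \<open>p (n + 1)\<close>; hence it is zero. \<open>pCons 0\<close> is
  multiplication by \<open>x\<close>.\<close>

lemma three_term_recurrence:
  obtains a where "p (n + 2) = [:- a, 1:] * p (n + 1) - Polynomial.smult (h (n + 1) / h n) (p n)"
proof -
  define a where "a = L (pCons 0 (p (n + 1)) * p (n + 1)) / h (n + 1)"
  define q where
    "q = pCons 0 (p (n + 1)) - Polynomial.smult a (p (n + 1)) - Polynomial.smult (h (n + 1) / h n) (p n) - p (n + 2)"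
  have ex: "L (p m * q) = L (p (n + 1) * pCons 0 (p m)) - a * L (p (n + 1) * p m)
      - h (n + 1) / h n * L (p n * p m) - L (p (n + 2) * p m)" for m
    by (simp add: q_def right_diff_distrib L_diff L_smult mult.commute)
  have "q = 0"
  proof (rule eq_0_if_orthogonal[of "n + 2"])
    fix i assume "i \<ge> n + 2"
    then show "coeff q i = 0"
      by (cases "i = n + 2") (auto simp: q_def coeff_pCons degree_p coeff_eq_0 lead_p[of "n + 2", simplified] lead_p[of "n + 1", simplified] split: nat.splits)
  next
    fix m assume "m < n + 2"
    then consider "m < n" | "m = n" | "m = n + 1" by linarith
    then show "L (p m * q) = 0"
    proof cases
      case 1
      \<comment> \<open>Multiplication by \<open>x\<close> is moved over to \<open>p m\<close>,
        whose degree then still stays below \<open>n + 1\<close>.\<close>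
      then have "L (p (n + 1) * pCons 0 (p m)) = 0"
        by (intro L_p_mult_lower_degree) (auto simp: coeff_pCons degree_p coeff_eq_0 split: nat.splits)
      with 1 show ?thesis unfolding ex by (simp add: orth)
    next
      case 2
      \<comment> \<open>Both \<open>x * p n\<close> and \<open>p (n + 1)\<close> are monic of degree
        \<open>n + 1\<close>. Hence \<open>x * p n\<close> pairs with \<open>p (n + 1)\<close> to
        \<open>h (n + 1)\<close>, which is where the coefficient \<open>h (n + 1) / h n\<close>
        comes from.\<close>
      have "L (p (n + 1) * (pCons 0 (p n) - p (n + 1))) = 0"
      proof (rule L_p_mult_lower_degree)
        fix i assume "i \<ge> n + 1"
        then show "coeff (pCons 0 (p n) - p (n + 1)) i = 0"
          by (cases "i = n + 1") (auto simp: coeff_pCons degree_p coeff_eq_0 lead_p lead_p[of "Suc n", simplified] split: nat.splits)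
      qed
      then have "L (p (n + 1) * pCons 0 (p n)) = h (n + 1)"
        by (simp add: right_diff_distrib L_diff norm_p)
      with 2 show ?thesis unfolding ex by (simp add: orth norm_p norm_nz)
    next
      case 3
      then show ?thesis unfolding ex
        using norm_nz[of "n+1"] by (simp add: orth norm_p a_def mult.commute)
    qed
  qed
  then have "p (n + 2) = [:- a, 1:] * p (n + 1) - Polynomial.smult (h (n + 1) / h n) (p n)"
    by (simp add: q_def algebra_simps)
  then show thesis by (rule that)
qed

text \<open>This is the confluent form, on the diagonal. Inserting the recurrence and its derivative
  into the Wronskian of \<open>p (n + 2)\<close> and \<open>p (n + 1)\<close> leaves
  \<open>p (n + 1)\<close> squared plus \<open>h (n + 1) / h n\<close> times the previous Wronskian,
  so the sum telescopes.\<close>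

lemma christoffel_darboux:
  "(\<Sum>j\<le>n. poly (p j) x ^ 2 / h j) =
     (poly (pderiv (p (n + 1))) x * poly (p n) x - poly (p (n + 1)) x * poly (pderiv (p n)) x) / h n"
proof (induction n)
  case 0
  obtain c where c: "p 0 = [:c:]" using degree_p[of 0] by (meson degree_eq_zeroE)
  then have c1: "c = 1" using lead_p[of 0] by simp
  have d: "pderiv (p 1) = 1"
    using degree_p[of 1] lead_p[of 1]
    by (intro poly_eqI) (auto simp: coeff_pderiv coeff_eq_0)
  show ?case using d c c1 by (simp add: pderiv_pCons)
next
  case (Suc n)
  obtain a where a: "p (n + 2) = [:- a, 1:] * p (n + 1) - Polynomial.smult (h (n + 1) / h n) (p n)"
    by (rule three_term_recurrence)
  have d: "pderiv (p (n + 2)) = [:- a, 1:] * pderiv (p (n + 1)) + p (n + 1) - Polynomial.smult (h (n + 1) / h n) (pderiv (p n))"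
    unfolding a by (simp add: pderiv_diff pderiv_smult pderiv_mult pderiv_pCons pderiv_add)
  have "(\<Sum>j\<le>Suc n. poly (p j) x ^ 2 / h j) = poly (p (n + 1)) x ^ 2 / h (n + 1) +
     (poly (pderiv (p (n + 1))) x * poly (p n) x - poly (p (n + 1)) x * poly (pderiv (p n)) x) / h n"
    using Suc.IH by simp
  also have "\<dots> = (poly (pderiv (p (n + 2))) x * poly (p (n + 1)) x -
      poly (p (n + 2)) x * poly (pderiv (p (n + 1))) x) / h (n + 1)"
    unfolding d unfolding a using norm_nz[of n] norm_nz[of "n + 1"]
    by (simp add: field_simps power2_eq_square)
  finally show ?case by simp
qed

end

section \<open>Vandermonde determinants in monic polynomials\<close>

text \<open>Let the last node be a variable \<open>y\<close>. The cofactors of the last row do not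
  involve \<open>y\<close>, so the determinant is a polynomial \<open>q\<close> in \<open>y\<close>;
  its coefficient at \<open>n\<close> is the smaller determinant \<open>V\<close>, and it vanishes
  at the earlier nodes because two rows coincide. Counting roots needs those nodes to be distinct;
  if they are not, both sides are zero.\<close>

lemma det_monic_vandermonde:
  fixes p :: "nat \<Rightarrow> 'a::field poly"
  assumes "\<And>j. j < n \<Longrightarrow> degree (p j) = j" and "\<And>j. j < n \<Longrightarrow> coeff (p j) j = 1"
  shows "Determinant.det (Matrix.mat n n (\<lambda>(i, j). poly (p j) (x i))) = (\<Prod>k<n. \<Prod>j<k. x k - x j)"
  using assms
proof (induction n)
  case (Suc n)
  define A where "A y = Matrix.mat (Suc n) (Suc n) (\<lambda>(i, j). poly (p j) ((x(n := y)) i))" for y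
  have A: "A y \<in> carrier_mat (Suc n) (Suc n)" for y by (simp add: A_def)
  define V where "V = (\<Prod>k<n. \<Prod>j<k. x k - x j)"
  define C where "C j = cofactor (A 0) n j" for j
  have minor: "mat_delete (A y) n j = mat_delete (A 0) n j" for y j
    by (auto simp: A_def mat_delete_def)
  define q where "q = (\<Sum>j<Suc n. Polynomial.smult (C j) (p j))"
  have q: "Determinant.det (A y) = poly q y" for y
  proof -
    have "Determinant.det (A y) = (\<Sum>j<Suc n. A y $$ (n, j) * cofactor (A y) n j)"
      by (rule laplace_expansion_row[OF A]) simp
    also have "\<dots> = poly q y"
    proof -
      have "A y $$ (n, j) = poly (p j) y" if "j < Suc n" for j
        using that by (simp add: A_def)
      then show ?thesis
        unfolding q_def poly_sum
        by (intro sum.cong refl) (simp add: C_def cofactor_def minor[of y] mult.commute)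
    qed
    finally show ?thesis .
  qed
  have Cn: "C n = V"
  proof -
    have "mat_delete (A 0) n n = Matrix.mat n n (\<lambda>(i, j). poly (p j) (x i))"
      by (auto simp: A_def mat_delete_def)
    then show ?thesis using Suc by (simp add: C_def cofactor_def V_def)
  qed
  have "poly q (x n) = V * (\<Prod>j<n. x n - x j)"
  proof (cases "inj_on x {..<n}")
    case False
    then obtain j k where jk: "j < n" "k < n" "j < k" "x j = x k"
      by (auto simp: inj_on_def) (metis nat_neq_iff)+
    then have "(\<Prod>i<k. x k - x i) = 0" by (intro prod_zero bexI[of _ j]) auto
    then have "\<exists>k\<in>{..<n}. (\<Prod>i<k. x k - x i) = 0" using jk(2) by blast
    then have "V = 0" unfolding V_def by (rule prod_zero[OF finite_lessThan])
    moreover have "Determinant.det (A (x n)) = 0"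
      by (rule det_identical_rows[OF A, of j k]) (use jk in \<open>auto simp: A_def Matrix.row_def\<close>)
    ultimately show ?thesis by (simp add: q)
  next
    case True
    \<comment> \<open>The terms of degree \<open>n\<close> cancel, so \<open>d\<close> has degree
      below \<open>n\<close> but \<open>n\<close> distinct roots.\<close>
    define d where "d = q - Polynomial.smult V (\<Prod>j<n. [:- x j, 1:])"
    have dP: "degree (\<Prod>j<n. [:- x j, 1:]) = n"
      by (subst degree_prod_sum_eq) auto
    have lP: "coeff (\<Prod>j<n. [:- x j, 1:]) n = 1"
      using lead_coeff_prod[of "\<lambda>j. [:- x j, 1:]" "{..<n}"] dP by simp
    have "coeff d i = 0" if "i \<ge> n" for i
    proof (cases "i = n")
      case True
      have "coeff q n = C n"
        using Suc.prems by (simp add: q_def coeff_sum coeff_eq_0)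
      then show ?thesis using True by (simp add: d_def lP Cn)
    next
      case False
      then show ?thesis using that Suc.prems dP
        by (auto simp: d_def q_def coeff_sum coeff_eq_0 intro!: sum.neutral)
    qed
    moreover have "poly d (x j) = 0" if "j < n" for j
    proof -
      have "Determinant.det (A (x j)) = 0"
        by (rule det_identical_rows[OF A, of j n]) (use that in \<open>auto simp: A_def Matrix.row_def\<close>)
      then show ?thesis using that by (auto simp: d_def q poly_prod)
    qed
    ultimately have "d = 0"
    proof -
      assume c: "\<And>i. i \<ge> n \<Longrightarrow> coeff d i = 0" and r: "\<And>j. j < n \<Longrightarrow> poly d (x j) = 0"
      show "d = 0"
      proof (rule ccontr)
        assume nz: "d \<noteq> 0"
        have "n = card (x ` {..<n})" using True by (simp add: card_image)
        also have "\<dots> \<le> card {y. poly d y = 0}"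
          using nz r by (intro card_mono poly_roots_finite) auto
        also have "\<dots> \<le> degree d" using nz by (rule card_poly_roots_bound)
        finally have "n \<le> degree d" .
        with c nz show False by (metis leading_coeff_0_iff)
      qed
    qed
    then show ?thesis by (simp add: d_def poly_prod)
  qed
  moreover have "A (x n) = Matrix.mat (Suc n) (Suc n) (\<lambda>(i, j). poly (p j) (x i))"
    by (auto simp: A_def)
  ultimately have "Determinant.det (Matrix.mat (Suc n) (Suc n) (\<lambda>(i, j). poly (p j) (x i))) =
      V * (\<Prod>j<n. x n - x j)"
    using q[of "x n"] by (simp only:)
  then show ?case unfolding V_def prod.lessThan_Suc .
qed simp

text \<open>In the Leibniz expansion every term is a product with one factor per coordinate, so it
  can be integrated one angle at a time.\<close>

lemma sum_permutes_monic_vandermonde: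
  fixes p :: "nat \<Rightarrow> 'a::field poly"
  assumes "\<And>j. j < n \<Longrightarrow> degree (p j) = j" and "\<And>j. j < n \<Longrightarrow> coeff (p j) j = 1"
  shows "(\<Sum>\<sigma> | \<sigma> permutes {..<n}. of_int (sign \<sigma>) * (\<Prod>i<n. poly (p (\<sigma> i)) (x i))) =
    (\<Prod>k<n. \<Prod>j<k. x k - x j)"
proof -
  have "Determinant.det (Matrix.mat n n (\<lambda>(i, j). poly (p j) (x i))) =
    (\<Sum>\<sigma> | \<sigma> permutes {0..<n}. of_int (sign \<sigma>) * (\<Prod>i=0..<n. poly (p (\<sigma> i)) (x i)))"
  proof (subst det_def'[of _ n])
    show "(\<Sum>\<sigma> | \<sigma> permutes {0..<n}. of_int (sign \<sigma>) *
        (\<Prod>i = 0..<n. Matrix.mat n n (\<lambda>(i, j). poly (p j) (x i)) $$ (i, \<sigma> i))) =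
      (\<Sum>\<sigma> | \<sigma> permutes {0..<n}. of_int (sign \<sigma>) * (\<Prod>i=0..<n. poly (p (\<sigma> i)) (x i)))"
    proof (rule sum.cong[OF refl])
      fix \<sigma> assume \<sigma>: "\<sigma> \<in> {\<sigma>. \<sigma> permutes {0..<n}}"
      have "(\<Prod>i = 0..<n. Matrix.mat n n (\<lambda>(i, j). poly (p j) (x i)) $$ (i, \<sigma> i)) =
        (\<Prod>i=0..<n. poly (p (\<sigma> i)) (x i))"
      proof (rule prod.cong[OF refl])
        fix i assume "i \<in> {0..<n}"
        moreover from this have "\<sigma> i \<in> {0..<n}" using \<sigma> permutes_in_image by fastforce
        ultimately show "Matrix.mat n n (\<lambda>(i, j). poly (p j) (x i)) $$ (i, \<sigma> i) = poly (p (\<sigma> i)) (x i)"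
          by simp
      qed
      then show "of_int (sign \<sigma>) * (\<Prod>i = 0..<n. Matrix.mat n n (\<lambda>(i, j). poly (p j) (x i)) $$ (i, \<sigma> i)) =
        of_int (sign \<sigma>) * (\<Prod>i=0..<n. poly (p (\<sigma> i)) (x i))" by (simp only:)
    qed
  qed simp
  then show ?thesis using det_monic_vandermonde[OF assms] by (simp add: lessThan_atLeast0)
qed

section \<open>Complex moments of the weight\<close>

text \<open>In the variable \<open>x = cos t\<close> this is a Beta integral, with weight
  \<open>(1 - x)^(s - 1/2) (1 + x)^(-1/2)\<close>.\<close>

definition cos_moment :: "complex \<Rightarrow> complex" where
  "cos_moment s = integral {0..pi} (\<lambda>t. complex_of_real (1 - cos t) powr s)"

lemma continuous_on_one_minus_cos_powr:
  assumes "Re s > 0"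
  shows "continuous_on A (\<lambda>t. complex_of_real (1 - cos t) powr s)"
  by (rule continuous_on_powr_complex) (use assms in \<open>auto intro!: continuous_intros\<close>)

lemma one_minus_cos_powr_integrable:
  assumes "Re s > 0"
  shows "(\<lambda>t. complex_of_real (1 - cos t) powr s) integrable_on {0..pi}"
  by (intro integrable_continuous_real continuous_on_one_minus_cos_powr assms)

lemma of_real_powr_plus_1:
  "complex_of_real u powr (s + 1) = of_real u powr s * of_real u"
  by (cases "u = 0") (simp_all add: powr_add)

text \<open>The exponent is shifted by one because \<open>0 powr 0\<close> is 0 whereas
  \<open>0 ^ 0\<close> is 1.\<close>

lemma of_real_powr_of_nat_plus_1:
  "complex_of_real u powr (of_nat n + 1) = of_real (u ^ (n + 1))"
proof (cases "u = 0")
  case False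
  then have "complex_of_real u powr of_nat n = of_real u ^ n" by (intro powr_nat') simp
  then show ?thesis by (simp add: of_real_powr_plus_1)
qed simp

text \<open>The function \<open>(1 - cos t)^s * sin t\<close> vanishes at both ends. Its derivative,
  after replacing \<open>sin t\<close> squared by \<open>(1 - cos t) * (1 + cos t)\<close>, is a
  combination of the powers \<open>s\<close> and \<open>s + 1\<close>.\<close>

lemma cos_moment_plus_1:
  assumes "Re s > 0"
  shows "(s + 1) * cos_moment (s + 1) = (2 * s + 1) * cos_moment s"
proof -
  define u where "u t = complex_of_real (1 - cos t)" for t
  have "((\<lambda>t. (2 * s + 1) * u t powr s - (s + 1) * u t powr (s + 1)) has_integral
      (u pi powr s * of_real (sin pi) - u 0 powr s * of_real (sin 0))) {0..pi}"
  \<comment> \<open>At \<open>t = 0\<close> the base of the power is 0, where the power is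
    continuous but in general not differentiable.\<close>
  proof (rule fundamental_theorem_of_calculus_interior)
    show "continuous_on {0..pi} (\<lambda>t. u t powr s * of_real (sin t))"
      unfolding u_def using assms
      by (intro continuous_intros continuous_on_one_minus_cos_powr) auto
    fix t assume t: "t \<in> {0<..<pi}"
    have "cos t < 1" using t cos_monotone_0_pi[of 0 t] by simp
    then have nz: "u t \<notin> \<real>\<^sub>\<le>\<^sub>0" "u t \<noteq> 0" by (auto simp: u_def complex_nonpos_Reals_iff)
    have u': "(u has_vector_derivative of_real (sin t)) (at t)"
      unfolding u_def by (rule derivative_eq_intros refl | simp)+
    have "((\<lambda>t. u t powr s) has_vector_derivative (of_real (sin t) * (s * u t powr (s - 1)))) (at t)"
      using field_vector_diff_chain_at[OF u' has_field_derivative_powr[OF nz(1), of s]]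
      by (simp add: o_def)
    then have "((\<lambda>t. u t powr s * of_real (sin t)) has_vector_derivative
       (u t powr s * of_real (cos t) + of_real (sin t) * (s * u t powr (s - 1)) * of_real (sin t))) (at t)"
      by (rule has_vector_derivative_mult) (auto intro!: derivative_eq_intros)
    moreover have "u t powr s * of_real (cos t) + of_real (sin t) * (s * u t powr (s - 1)) * of_real (sin t)
      = (2 * s + 1) * u t powr s - (s + 1) * u t powr (s + 1)"
    proof -
      have p: "u t powr s = u t powr (s - 1) * u t" "u t powr (s + 1) = u t powr (s - 1) * u t * u t"
        using nz by (simp_all add: powr_add powr_diff)
      have "sin t * sin t = (1 - cos t) * (1 + cos t)"
        using sin_squared_eq[of t] by (simp add: power2_eq_square algebra_simps)
      then have "complex_of_real (sin t * sin t) = of_real ((1 - cos t) * (1 + cos t))" by (simp only:)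
      then have "of_real (sin t) * of_real (sin t) = (1 - complex_of_real (cos t)) * (1 + of_real (cos t))"
        by (simp only: of_real_mult of_real_diff of_real_add of_real_1)
      moreover have "of_real (sin t) * (s * u t powr (s - 1)) * of_real (sin t) =
        s * u t powr (s - 1) * (of_real (sin t) * complex_of_real (sin t))" by (simp only: mult_ac)
      ultimately have "of_real (sin t) * (s * u t powr (s - 1)) * of_real (sin t) =
        s * u t powr (s - 1) * ((1 - complex_of_real (cos t)) * (1 + of_real (cos t)))" by (simp only:)
      then show ?thesis unfolding p by (simp add: u_def algebra_simps)
    qed
    ultimately show "((\<lambda>t. u t powr s * of_real (sin t)) has_vector_derivative
      ((2 * s + 1) * u t powr s - (s + 1) * u t powr (s + 1))) (at t)" by simp
  qed simp
  then have "integral {0..pi} (\<lambda>t. (2 * s + 1) * u t powr s - (s + 1) * u t powr (s + 1)) = 0"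
    by (simp add: integral_unique)
  moreover have "integral {0..pi} (\<lambda>t. (2 * s + 1) * u t powr s - (s + 1) * u t powr (s + 1)) =
     (2 * s + 1) * cos_moment s - (s + 1) * cos_moment (s + 1)"
    unfolding cos_moment_def u_def
    by (subst integral_diff) (use assms in \<open>auto intro!: integrable_on_mult_right one_minus_cos_powr_integrable simp del: of_real_diff\<close>)
  ultimately show ?thesis by simp
qed

lemma Re_pos_not_nonpos_Int: "Re s > 0 \<Longrightarrow> s \<notin> \<int>\<^sub>\<le>\<^sub>0"
  by (auto elim!: nonpos_Ints_cases)

lemma pochhammer_nonzero_if_Re_pos: "Re s > 0 \<Longrightarrow> pochhammer s n \<noteq> 0"
  by (auto simp: pochhammer_eq_0_iff)

lemma cos_moment_plus_of_nat:
  assumes "Re s > 0"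
  shows "cos_moment (s + of_nat n) =
    2 ^ n * (pochhammer (s + 1 / 2) n / pochhammer (s + 1) n) * cos_moment s"
proof (induction n)
  case (Suc n)
  have "(s + of_nat n + 1) * cos_moment (s + of_nat n + 1) =
      (2 * (s + of_nat n) + 1) * cos_moment (s + of_nat n)"
    by (rule cos_moment_plus_1) (use assms in simp)
  moreover have "s + of_nat n + 1 \<noteq> 0" using assms
    by (auto simp: complex_eq_iff)
  ultimately have "cos_moment (s + of_nat (Suc n)) =
      (2 * (s + of_nat n) + 1) / (s + of_nat n + 1) * cos_moment (s + of_nat n)"
    by (simp add: field_simps)
  moreover have "2 * (s + of_nat n) + 1 = 2 * (s + 1 / 2 + of_nat n)" "s + of_nat n + 1 = s + 1 + of_nat n"
    by (simp_all add: algebra_simps)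
  ultimately show ?case
    unfolding Suc.IH pochhammer_Suc power_Suc by (simp only: times_divide_times_eq times_divide_eq_left times_divide_eq_right divide_divide_eq_left mult_ac)
qed simp

section \<open>Asymptotics and closed form of the moments\<close>

text \<open>In Euler's limit for Gamma each factor carries a power \<open>n^z\<close>; the balance
  \<open>a + b = c + d\<close> makes these powers cancel.\<close>

lemma pochhammer_ratio_LIMSEQ:
  fixes a b c d :: complex
  assumes "a + b = c + d" "a \<notin> \<int>\<^sub>\<le>\<^sub>0" "b \<notin> \<int>\<^sub>\<le>\<^sub>0" "c \<notin> \<int>\<^sub>\<le>\<^sub>0" "d \<notin> \<int>\<^sub>\<le>\<^sub>0"
  shows "(\<lambda>n. pochhammer a n * pochhammer b n / (pochhammer c n * pochhammer d n)) \<longlonglongrightarrow>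
     Gamma c * Gamma d / (Gamma a * Gamma b)"
proof -
  have "(\<lambda>n. Gamma_series' c n * Gamma_series' d n / (Gamma_series' a n * Gamma_series' b n)) \<longlonglongrightarrow>
     Gamma c * Gamma d / (Gamma a * Gamma b)"
    using assms by (intro tendsto_intros Gamma_series'_LIMSEQ) (auto simp: Gamma_eq_zero_iff)
  moreover have "Gamma_series' c n * Gamma_series' d n / (Gamma_series' a n * Gamma_series' b n) =
    pochhammer a n * pochhammer b n / (pochhammer c n * pochhammer d n)" for n
  proof -
    let ?l = "complex_of_real (ln (of_nat n))"
    have e: "exp (a * ?l) * exp (b * ?l) = exp (c * ?l) * exp (d * ?l)"
      using assms(1) by (simp flip: exp_add distrib_right)
    have "pochhammer z n \<noteq> 0" if "z \<in> {a, b, c, d}" for z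
      using that assms by (auto simp: pochhammer_eq_0_iff)
    then have "Gamma_series' c n * Gamma_series' d n / (Gamma_series' a n * Gamma_series' b n) =
      (exp (c * ?l) * exp (d * ?l)) / (exp (a * ?l) * exp (b * ?l)) *
      (pochhammer a n * pochhammer b n / (pochhammer c n * pochhammer d n))"
      unfolding Gamma_series'_def by (simp add: field_simps)
    then show ?thesis unfolding e by simp
  qed
  ultimately show ?thesis by simp
qed

text \<open>Mean value inequality on the segment \<open>(0, 2]\<close>: the derivative
  \<open>s * z powr (s - 1)\<close> is largest in modulus at 2 because \<open>Re s \<ge> 1\<close>.
  At \<open>u = 0\<close> the claim reduces to \<open>cmod s \<ge> 1\<close>.\<close>

lemma powr_Lipschitz_at_2:
  assumes s: "Re s \<ge> 1" and u: "0 \<le> u" "u \<le> 2"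
  shows "cmod (complex_of_real u powr s - 2 powr s) \<le> cmod s * 2 powr (Re s - 1) * (2 - u)"
proof (cases "u = 0")
  case True
  have "1 \<le> cmod s" using s complex_Re_le_cmod[of s] by linarith
  then have "2 powr Re s \<le> cmod s * 2 powr Re s" by simp
  then show ?thesis using True by (simp add: norm_powr_real_powr powr_diff)
next
  case False
  let ?S = "complex_of_real ` {0<..2}"
  have "cmod (of_real u powr s - of_real 2 powr s) \<le> cmod s * 2 powr (Re s - 1) * cmod (complex_of_real u - of_real 2)"
  proof (rule field_differentiable_bound[where S = ?S and f' = "\<lambda>z. s * z powr (s - 1)"])
    show "convex ?S" by (intro convex_linear_image) (auto simp: linear_iff of_real_def algebra_simps)
    fix z assume "z \<in> ?S"
    then obtain x where x: "z = of_real x" "0 < x" "x \<le> 2" by auto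
    show "((\<lambda>z. z powr s) has_field_derivative s * z powr (s - 1)) (at z within ?S)"
      by (rule DERIV_subset[OF has_field_derivative_powr]) (use x in \<open>auto simp: complex_nonpos_Reals_iff\<close>)
    show "cmod (s * z powr (s - 1)) \<le> cmod s * 2 powr (Re s - 1)"
      using x s by (auto simp: norm_mult norm_powr_real_powr intro!: mult_left_mono powr_mono2)
  qed (use u False in \<open>auto intro!: image_eqI[of _ _ 2]\<close>)
  moreover have "cmod (complex_of_real u - of_real 2) = 2 - u"
    using u by (simp only: of_real_diff[symmetric] norm_of_real)
  ultimately show ?thesis by simp
qed

lemma cos_moment_1: "cos_moment 1 = of_real pi"
proof -
  have "((\<lambda>t. complex_of_real (1 - cos t)) has_integral (of_real (pi - sin pi) - of_real (0 - sin 0))) {0..pi}"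
    by (rule fundamental_theorem_of_calculus)
       (auto intro!: derivative_eq_intros simp flip: has_real_derivative_iff_has_vector_derivative
         simp: has_vector_derivative_of_real)
  then show ?thesis by (simp add: cos_moment_def integral_unique)
qed

lemma cos_moment_of_nat:
  "cos_moment (of_nat n + 1) = of_real (integral {0..pi} (\<lambda>t. (1 - cos t) ^ (n + 1)))"
proof -
  have "cos_moment (of_nat n + 1) = integral {0..pi} (\<lambda>t. complex_of_real ((1 - cos t) ^ (n + 1)))"
    unfolding cos_moment_def
    by (simp only: of_real_powr_of_nat_plus_1)
  also have "\<dots> = of_real (integral {0..pi} (\<lambda>t. (1 - cos t) ^ (n + 1)))"
  proof -
    have "((\<lambda>t. (1 - cos t) ^ (n + 1)) has_integral integral {0..pi} (\<lambda>t. (1 - cos t) ^ (n + 1))) {0..pi}"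
      by (intro integrable_integral integrable_continuous_real continuous_intros)
    from has_integral_linear[OF this bounded_linear_of_real[where 'a = complex]]
    show ?thesis by (simp add: o_def integral_unique)
  qed
  finally show ?thesis .
qed

text \<open>The measure $(1 - \cos t)^{n+1}\,dt$ concentrates at $t = \pi$, where $(1 - \cos t)^s = 2^s$.\<close>

lemma cos_moment_asymp:
  assumes s: "Re s \<ge> 1"
  shows "(\<lambda>n. cos_moment (s + of_nat n + 1) / cos_moment (of_nat n + 1)) \<longlonglongrightarrow> 2 powr s"
proof -
  define K where "K = cmod s * 2 powr (Re s - 1)"
  define I where "I n = integral {0..pi} (\<lambda>t. (1 - cos t) ^ (n + 1))" for n
  have int: "(\<lambda>t. (1 - cos t) ^ n) integrable_on {0..pi}" for n
    by (intro integrable_continuous_real continuous_intros)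
  have rec: "(real n + 2) * I (Suc n) = (2 * real n + 3) * I n" for n
  proof -
    have "(of_nat n + 1 + 1) * cos_moment (of_nat n + 1 + 1) = (2 * (of_nat n + 1) + 1) * cos_moment (of_nat n + 1)"
      by (rule cos_moment_plus_1) simp
    moreover have "cos_moment (of_nat k + 1) = of_real (I k)" for k
      by (simp only: I_def cos_moment_of_nat)
    from this[of n] this[of "Suc n"]
    have "cos_moment (of_nat n + 1) = of_real (I n)" "cos_moment (of_nat n + 1 + 1) = of_real (I (Suc n))"
      by (simp_all only: of_nat_Suc add_ac)
    ultimately have "complex_of_real ((real n + 1 + 1) * I (Suc n)) = of_real ((2 * (real n + 1) + 1) * I n)"
      by (simp only: of_real_mult of_real_add of_real_of_nat_eq of_real_1 of_real_numeral)
    then have "(real n + 1 + 1) * I (Suc n) = (2 * (real n + 1) + 1) * I n"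
      by (simp only: of_real_eq_iff)
    then show ?thesis by (simp add: algebra_simps)
  qed
  have "I 0 = pi"
  proof -
    have "complex_of_real (I 0) = of_real pi"
      using cos_moment_of_nat[of 0] cos_moment_1 by (simp add: I_def)
    then show ?thesis by simp
  qed
  have pos: "I n > 0" for n
  proof (induction n)
    case (Suc n)
    then have "(real n + 2) * I (Suc n) > 0" unfolding rec by (intro mult_pos_pos) auto
    then show ?case by (rule zero_less_mult_pos) simp
  qed (simp add: \<open>I 0 = pi\<close>)
  \<comment> \<open>Writing \<open>u\<close> for \<open>1 - cos t\<close>, the error
    \<open>u powr s - 2 powr s\<close> is at most \<open>K * (2 - u)\<close>. The average of
    \<open>2 - u\<close> against \<open>u ^ (n + 1)\<close> is computed exactly by the recurrence:
    \<open>2 * I n - I (Suc n) = I n / (n + 2)\<close>.\<close>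
  have bound: "cmod (cos_moment (s + of_nat n + 1) / cos_moment (of_nat n + 1) - 2 powr s) \<le> K * (1 / real (n + 2))" for n
  proof -
    have i1: "(\<lambda>t. complex_of_real (1 - cos t) powr (s + of_nat n + 1)) integrable_on {0..pi}"
      and i2: "(\<lambda>t. complex_of_real (1 - cos t) powr (of_nat n + 1)) integrable_on {0..pi}"
      using s by (auto intro!: one_minus_cos_powr_integrable simp del: of_real_diff)
    have "cos_moment (s + of_nat n + 1) - 2 powr s * cos_moment (of_nat n + 1) =
      integral {0..pi} (\<lambda>t. complex_of_real (1 - cos t) powr (s + of_nat n + 1) - 2 powr s * complex_of_real (1 - cos t) powr (of_nat n + 1))"
      unfolding cos_moment_def
      by (subst integral_diff[OF i1 integrable_on_mult_right[OF i2]]) simp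
    also have "cmod \<dots> \<le> integral {0..pi} (\<lambda>t. K * (2 * (1 - cos t) ^ (n + 1) - (1 - cos t) ^ (Suc n + 1)))"
    proof (rule integral_norm_bound_integral)
      show "(\<lambda>t. complex_of_real (1 - cos t) powr (s + of_nat n + 1) - 2 powr s * complex_of_real (1 - cos t) powr (of_nat n + 1)) integrable_on {0..pi}"
        by (intro integrable_diff integrable_on_mult_right i1 i2)
      show "(\<lambda>t. K * (2 * (1 - cos t) ^ (n + 1) - (1 - cos t) ^ (Suc n + 1))) integrable_on {0..pi}"
        by (intro integrable_diff integrable_on_mult_right int)
      fix t :: real
      define u where "u = 1 - cos t"
      have u: "0 \<le> u" "u \<le> 2"
        using cos_ge_minus_one[of t] cos_le_one[of t] unfolding u_def by linarith+
      have p: "complex_of_real u powr (s + of_nat n + 1) = of_real u powr s * of_real (u ^ (n + 1))"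
      proof (cases "u = 0")
        case False
        then have "complex_of_real u powr (s + (of_nat n + 1)) = of_real u powr s * of_real u powr (of_nat n + 1)"
          by (intro powr_add)
        then show ?thesis by (simp only: of_real_powr_of_nat_plus_1 add.assoc)
      qed simp
      have "cmod (complex_of_real u powr (s + of_nat n + 1) - 2 powr s * complex_of_real u powr (of_nat n + 1)) =
        cmod (complex_of_real u powr s - 2 powr s) * u ^ (n + 1)"
        unfolding p of_real_powr_of_nat_plus_1 left_diff_distrib[symmetric] norm_mult norm_of_real
        using u by simp
      also have "\<dots> \<le> (K * (2 - u)) * u ^ (n + 1)"
        unfolding K_def using powr_Lipschitz_at_2[OF s u] u by (intro mult_right_mono) auto
      also have "\<dots> = K * (2 * u ^ (n + 1) - u ^ (Suc n + 1))" by (simp add: algebra_simps)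
      finally show "cmod (complex_of_real (1 - cos t) powr (s + of_nat n + 1) - 2 powr s * complex_of_real (1 - cos t) powr (of_nat n + 1))
        \<le> K * (2 * (1 - cos t) ^ (n + 1) - (1 - cos t) ^ (Suc n + 1))" by (simp add: u_def)
    qed
    also have "\<dots> = K * (2 * I n - I (Suc n))"
      unfolding I_def integral_mult_right
      by (subst integral_diff) (auto intro!: integrable_on_mult_right int simp del: power_Suc)
    also have "2 * I n - I (Suc n) = I n / (n + 2)"
      using rec[of n] by (simp add: field_simps)
    finally have *: "cmod (cos_moment (s + of_nat n + 1) - 2 powr s * cos_moment (of_nat n + 1)) \<le> K * (I n / (n + 2))" .
    have cm: "cos_moment (of_nat n + 1) = of_real (I n)" by (simp only: I_def cos_moment_of_nat)
    have "Z / of_real x - p = (Z - p * of_real x) / of_real x" if "x > 0" for Z p :: complex and x :: real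
      using that by (simp add: diff_divide_distrib)
    then have "cmod (cos_moment (s + of_nat n + 1) / cos_moment (of_nat n + 1) - 2 powr s) =
      cmod (cos_moment (s + of_nat n + 1) - 2 powr s * cos_moment (of_nat n + 1)) / I n"
      unfolding cm using pos[of n] by (simp add: norm_divide)
    also have "\<dots> \<le> K * (I n / (n + 2)) / I n"
      using * pos[of n] by (intro divide_right_mono) auto
    also have "\<dots> = K * (1 / real (n + 2))" using pos[of n] by simp
    finally show ?thesis .
  qed
  have ev: "\<forall>\<^sub>F n in sequentially. cmod (cos_moment (s + of_nat n + 1) / cos_moment (of_nat n + 1) - 2 powr s) \<le> K * (1 / real (n + 2))"
    by (rule always_eventually, rule allI, rule bound)
  have "(\<lambda>n. K * (1 / real (n + 2))) \<longlonglongrightarrow> K * 0"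
    by (intro tendsto_mult tendsto_const LIMSEQ_ignore_initial_segment[OF lim_1_over_n])
  then have "(\<lambda>n. K * (1 / real (n + 2))) \<longlonglongrightarrow> 0" by (simp only: mult_zero_right)
  then have "(\<lambda>n. cos_moment (s + of_nat n + 1) / cos_moment (of_nat n + 1) - 2 powr s) \<longlonglongrightarrow> 0"
    by (rule Lim_null_comparison[OF ev])
  from LIM_zero_cancel[OF this] show ?thesis .
qed

text \<open>\<open>cos_moment s\<close> is determined by its recurrence in \<open>s\<close> together with its behaviour at \<open>s + n\<close> for large \<open>n\<close>.\<close>

lemma cos_moment_eq:
  assumes s: "Re s > 0"
  shows "cos_moment s = 2 powr s * (Gamma (s + 1 / 2) * Gamma (1 / 2) / Gamma (s + 1))"
proof -
  \<comment> \<open>The asymptotics require real part at least 1, so they are used at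
    \<open>s + 1\<close>; this is why the shift is \<open>n + 2\<close>.\<close>
  have lim1: "(\<lambda>n. cos_moment (s + of_nat (n + 2)) / cos_moment (of_nat n + 1)) \<longlonglongrightarrow> 2 powr (s + 1)"
    using cos_moment_asymp[of "s + 1"] s by (simp add: algebra_simps)
  \<comment> \<open>The recurrence turns the quotient into a balanced one,
    \<open>(s + 1 / 2) + 1 = (s + 1) + 1 / 2\<close>, to which
    \<open>pochhammer_ratio_LIMSEQ\<close> applies. The last factor, which tends to 1, accounts for
    the additional shift by one.\<close>
  have eq: "cos_moment (s + of_nat (n + 2)) / cos_moment (of_nat n + 1) =
    2 * cos_moment s / of_real pi * (pochhammer (s + 1 / 2) (n + 1) * pochhammer 1 (n + 1) /
       (pochhammer (s + 1) (n + 1) * pochhammer (1 / 2) (n + 1))) *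
      ((s + 3 / 2 + of_nat n) / (s + 2 + of_nat n))" for n
  proof -
    have a: "cos_moment (of_nat n + 1) = 2 ^ n * (pochhammer (3 / 2) n / pochhammer 2 n) * of_real pi"
      using cos_moment_plus_of_nat[of 1 n] cos_moment_1 by (simp add: add.commute)
    have b: "pochhammer 1 (n + 1) = pochhammer (2 :: complex) n" "pochhammer (1 / 2 :: complex) (n + 1) = pochhammer (3 / 2) n / 2"
      by (simp_all add: pochhammer_rec)
    have c: "pochhammer (s + 1 / 2) (n + 2) = pochhammer (s + 1 / 2) (n + 1) * (s + 3 / 2 + of_nat n)"
       "pochhammer (s + 1) (n + 2) = pochhammer (s + 1) (n + 1) * (s + 2 + of_nat n)"
      by (simp_all add: pochhammer_Suc algebra_simps)
    have gen: "2 ^ (n + 2) * (A * B / (C * D)) * m / (2 ^ n * (E / F) * w) =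
        2 * m / w * (A * F / (C * (E / 2))) * (B / D)" for A B C D E F m w :: complex
    proof (cases "F = 0 \<or> E = 0 \<or> C = 0 \<or> D = 0 \<or> w = 0")
      case False
      then show ?thesis by (simp add: divide_simps power_add)
    qed auto
    show ?thesis
      unfolding cos_moment_plus_of_nat[OF s] a b c by (rule gen)
  qed
  have lim2: "(\<lambda>n. (s + 3 / 2 + of_nat n) / (s + 2 + of_nat n)) \<longlonglongrightarrow> 1"
  proof -
    have "(\<lambda>n. 1 - (1 / 2) * inverse (s + 2 + of_nat n)) \<longlonglongrightarrow> 1 - (1 / 2) * 0"
      by (intro tendsto_intros filterlim_compose[OF tendsto_inverse_0] tendsto_add_filterlim_at_infinity[OF tendsto_const] tendsto_of_nat)
    moreover have "1 - (1 / 2) * inverse (s + 2 + of_nat n) = (s + 3 / 2 + of_nat n) / (s + 2 + of_nat n)" for n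
    proof -
      have "s + 2 + of_nat n \<noteq> 0" using s by (auto simp: complex_eq_iff)
      moreover have "s + 3 / 2 + of_nat n = (s + 2 + of_nat n) - 1 / 2" by simp
      ultimately show ?thesis by (simp only: diff_divide_distrib divide_self inverse_eq_divide) simp
    qed
    ultimately show ?thesis by simp
  qed
  have lim3: "(\<lambda>n. pochhammer (s + 1 / 2) (n + 1) * pochhammer 1 (n + 1) /
       (pochhammer (s + 1) (n + 1) * pochhammer (1 / 2) (n + 1))) \<longlonglongrightarrow>
      Gamma (s + 1) * Gamma (1 / 2) / (Gamma (s + 1 / 2) * Gamma 1)"
    by (rule LIMSEQ_ignore_initial_segment[OF pochhammer_ratio_LIMSEQ])
      (use s in \<open>auto intro!: Re_pos_not_nonpos_Int\<close>)
  have "(\<lambda>n. cos_moment (s + of_nat (n + 2)) / cos_moment (of_nat n + 1)) \<longlonglongrightarrow>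
     2 * cos_moment s / of_real pi * (Gamma (s + 1) * Gamma (1 / 2) / (Gamma (s + 1 / 2) * Gamma 1)) * 1"
    unfolding eq by (intro tendsto_intros lim2 lim3) auto
  from LIMSEQ_unique[OF this lim1]
  have "2 * cos_moment s / of_real pi * (Gamma (s + 1) * Gamma (1 / 2) / Gamma (s + 1 / 2)) = 2 * 2 powr s"
    by (simp add: powr_add)
  moreover have "of_real pi = Gamma (1 / 2 :: complex) * Gamma (1 / 2)"
    using Gamma_one_half_complex by (simp flip: of_real_mult)
  ultimately have "2 * cos_moment s / (Gamma (1 / 2) * Gamma (1 / 2)) *
      (Gamma (s + 1) * Gamma (1 / 2) / Gamma (s + 1 / 2)) = 2 * 2 powr s"
    by (simp only:)
  moreover have "Gamma (s + 1) \<noteq> 0" "Gamma (s + 1 / 2) \<noteq> 0" "Gamma (1 / 2 :: complex) \<noteq> 0"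
    using s by (simp_all add: Gamma_eq_zero_iff Re_pos_not_nonpos_Int)
  moreover have "2 * m / (h * h) * (A * h / B) = 2 * p \<Longrightarrow> A \<noteq> 0 \<Longrightarrow> B \<noteq> 0 \<Longrightarrow> h \<noteq> 0 \<Longrightarrow>
      m = p * (B * h / A)" for m p A B h :: complex
    by (simp add: field_simps)
  ultimately show ?thesis by blast
qed

section \<open>Jacobi polynomials\<close>

text \<open>In the variable \<open>x = cos t\<close>, integration against the Jacobi weight
  \<open>(1 - x)^(r - 1/2) (1 + x)^(-1/2)\<close> on \<open>[-1, 1]\<close>.\<close>

definition jacobi_functional :: "complex \<Rightarrow> complex poly \<Rightarrow> complex" where
  "jacobi_functional r q =
     integral {0..pi} (\<lambda>t. poly q (of_real (cos t)) * complex_of_real (1 - cos t) powr r)"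

lemma continuous_on_jacobi_weight:
  assumes "Re r > 0"
  shows "continuous_on A (\<lambda>t. poly q (of_real (cos t)) * complex_of_real (1 - cos t) powr r)"
  by (intro continuous_intros continuous_on_one_minus_cos_powr assms)

lemma jacobi_weight_integrable:
  assumes "Re r > 0"
  shows "(\<lambda>t. poly q (of_real (cos t)) * complex_of_real (1 - cos t) powr r) integrable_on {0..pi}"
  by (intro integrable_continuous_real continuous_on_jacobi_weight assms)

lemma jacobi_functional_add:
  assumes "Re r > 0"
  shows "jacobi_functional r (p + q) = jacobi_functional r p + jacobi_functional r q"
  unfolding jacobi_functional_def poly_add distrib_right
  by (rule integral_add[OF jacobi_weight_integrable[OF assms] jacobi_weight_integrable[OF assms]])

lemma jacobi_functional_smult:
  "jacobi_functional r (Polynomial.smult a q) = a * jacobi_functional r q"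
  unfolding jacobi_functional_def poly_smult mult.assoc by (rule integral_mult_right)

lemma jacobi_functional_sum:
  assumes "Re r > 0"
  shows "jacobi_functional r (sum f A) = (\<Sum>x\<in>A. jacobi_functional r (f x))"
  using jacobi_functional_add[OF assms] jacobi_functional_smult[of r 0 0]
  by (induction A rule: infinite_finite_induct) auto

lemma of_real_powr_plus_of_nat:
  "complex_of_real u powr (r + of_nat k) = of_real u ^ k * of_real u powr r"
proof (cases "u = 0")
  case False
  then have "complex_of_real u powr of_nat k = of_real u ^ k" by (intro powr_nat') simp
  with False show ?thesis by (simp add: powr_add)
qed (simp add: power_0_left)

text \<open>A Beta integral, reduced to \<open>cos_moment\<close> by induction on \<open>m\<close>:
  writing \<open>1 + x = 2 - (1 - x)\<close> trades a factor \<open>1 + x\<close> for moments with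
  exponents \<open>k\<close> and \<open>k + 1\<close>, hence the generalization over
  \<open>k\<close>.\<close>

lemma jacobi_functional_moment:
  assumes r: "Re r > 0"
  shows "jacobi_functional r ([:1, -1:] ^ k * [:1, 1:] ^ m) =
    2 powr (r + of_nat k + of_nat m) * Gamma (r + of_nat k + 1 / 2) * Gamma (of_nat m + 1 / 2)
      / Gamma (r + of_nat k + of_nat m + 1)"
proof (induction m arbitrary: k)
  case 0
  have "jacobi_functional r ([:1, -1:] ^ k * [:1, 1:] ^ 0) = cos_moment (r + of_nat k)"
    unfolding jacobi_functional_def cos_moment_def of_real_powr_plus_of_nat by simp
  then show ?case using r by (simp add: cos_moment_eq)
next
  case (Suc m)
  define a where "a = r + of_nat k + 1 / 2"
  define b where "b = of_nat m + (1 / 2 :: complex)"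
  define s where "s = r + of_nat k + of_nat m + 1"
  have s: "s = a + b" by (simp add: s_def a_def b_def)
  have Re: "Re a > 0" "Re b > 0" "Re s > 0" using r by (simp_all add: a_def b_def s_def)
  have "[:1, -1:] ^ k * [:1, 1:] ^ Suc m =
      Polynomial.smult 2 ([:1, -1:] ^ k * [:1, 1:] ^ m) + Polynomial.smult (- 1) ([:1, -1:] ^ Suc k * [:1, 1 :: complex:] ^ m)"
  proof -
    have "[:1, 1:] * q = Polynomial.smult 2 q + Polynomial.smult (- 1) ([:1, -1:] * q)" for q :: "complex poly"
      by (rule poly_eqI) (simp add: coeff_pCons split: nat.splits)
    from this[of "[:1, -1:] ^ k * [:1, 1:] ^ m"] show ?thesis
      by (simp only: power_Suc mult_ac)
  qed
  then have "jacobi_functional r ([:1, -1:] ^ k * [:1, 1:] ^ Suc m) =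
      2 * jacobi_functional r ([:1, -1:] ^ k * [:1, 1:] ^ m) - jacobi_functional r ([:1, -1:] ^ Suc k * [:1, 1:] ^ m)"
    by (simp only: jacobi_functional_add[OF r] jacobi_functional_smult) simp
  also have "jacobi_functional r ([:1, -1:] ^ k * [:1, 1:] ^ m) =
      2 powr (s - 1) * Gamma a * Gamma b / Gamma s"
    unfolding Suc.IH by (simp add: a_def b_def s_def)
  also have "jacobi_functional r ([:1, -1:] ^ Suc k * [:1, 1:] ^ m) =
      2 powr s * Gamma (a + 1) * Gamma b / Gamma (s + 1)"
    unfolding Suc.IH by (simp add: a_def b_def s_def add_ac)
  also have "2 * (2 powr (s - 1) * Gamma a * Gamma b / Gamma s) - 2 powr s * Gamma (a + 1) * Gamma b / Gamma (s + 1) =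
      2 powr s * Gamma a * Gamma (b + 1) / Gamma (s + 1)"
  \<comment> \<open>Over the common denominator \<open>s * Gamma s\<close> the numerators differ by
    the factor \<open>s - a\<close>, which is \<open>b\<close>.\<close>
  proof -
    have G: "Gamma (a + 1) = a * Gamma a" "Gamma (b + 1) = b * Gamma b" "Gamma (s + 1) = s * Gamma s"
      using Re by (simp_all add: Gamma_plus1 Re_pos_not_nonpos_Int)
    have "s \<noteq> 0" using Re by auto
    have "2 * (2 powr (s - 1) * Gamma a * Gamma b / Gamma s) = 2 powr s * Gamma a * Gamma b * s / (s * Gamma s)"
      using \<open>s \<noteq> 0\<close> by (simp add: powr_diff)
    then show ?thesis unfolding G
      by (simp add: s field_simps flip: diff_divide_distrib)
  qed
  also have "\<dots> = 2 powr (r + of_nat k + of_nat (Suc m)) * Gamma (r + of_nat k + 1 / 2) * Gamma (of_nat (Suc m) + 1 / 2)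
      / Gamma (r + of_nat k + of_nat (Suc m) + 1)"
    by (simp add: a_def b_def s_def add_ac)
  finally show ?case .
qed

section \<open>Jacobi polynomials as finite sums: orthogonality and norms\<close>

text \<open>The terminating hypergeometric sum in powers of \<open>(1 - x) / 2\<close> for
  \<open>\<alpha> = r - 1/2\<close> and \<open>\<beta> = -1/2\<close>, so that
  \<open>n + \<alpha> + \<beta> + 1 = n + r\<close> and
  \<open>\<alpha> + 1 = r + 1/2\<close>.\<close>

definition jacobi_as_poly :: "nat \<Rightarrow> complex \<Rightarrow> complex poly" where
  "jacobi_as_poly n r = (\<Sum>k\<le>n. Polynomial.smult
     (((of_nat n + r - 1 / 2) gchoose n) * (pochhammer (- of_nat n) k * pochhammer (of_nat n + r) k /
        (pochhammer (r + 1 / 2) k * fact k)) / 2 ^ k) ([:1, -1:] ^ k))"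

definition jacobi_lead :: "nat \<Rightarrow> complex \<Rightarrow> complex" where
  "jacobi_lead n r = pochhammer (of_nat n + r) n / (fact n * 2 ^ n)"

lemma jacobi_poly_eq_poly:
  "jacobi_poly n (r - 1 / 2) (- 1 / 2) x = poly (jacobi_as_poly n r) x"
proof -
  define F where "F = fps_hypergeo [- of_nat n, of_nat n + r] [r + 1 / 2 :: complex] 1"
  have nth: "fps_nth F k = pochhammer (- of_nat n) k * pochhammer (of_nat n + r) k / (pochhammer (r + 1 / 2) k * fact k)" for k
    by (simp add: F_def)
  have "eval_fps F z = (\<Sum>k\<le>n. fps_nth F k * z ^ k)" for z
    unfolding eval_fps_def
    by (rule suminf_finite) (auto simp: nth pochhammer_of_nat_eq_0_iff)
  moreover have "jacobi_poly n (r - 1 / 2) (- 1 / 2) x = ((of_nat n + r - 1 / 2) gchoose n) * eval_fps F ((1 - x) / 2)"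
    by (simp add: jacobi_poly_def F_def algebra_simps)
  ultimately show ?thesis
    by (simp add: jacobi_as_poly_def poly_sum nth sum_distrib_left power_divide algebra_simps)
qed

lemma coeff_linear_power_eq_0: "coeff ([:a, b :: complex:] ^ k) i = 0" if "k < i"
proof -
  have "degree ([:a, b:] ^ k) \<le> degree [:a, b:] * k" by (rule degree_power_le)
  also have "\<dots> \<le> k" by simp
  finally show ?thesis using that by (simp add: coeff_eq_0)
qed

lemma gchoose_eq_pochhammer_half: "((of_nat n + r - 1 / 2) gchoose n) = pochhammer (r + 1 / 2) n / (fact n :: complex)"
  by (simp add: gbinomial_pochhammer' algebra_simps)

text \<open>Only the summand \<open>k = n\<close> reaches degree \<open>n\<close>. The sign of
  \<open>(1 - x) ^ n\<close> cancels that of \<open>pochhammer (- n) n\<close>.\<close>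

lemma coeff_jacobi_as_poly:
  assumes "Re r > 0"
  shows "i > n \<Longrightarrow> coeff (jacobi_as_poly n r) i = 0"
    and "coeff (jacobi_as_poly n r) n = jacobi_lead n r"
proof -
  show "i > n \<Longrightarrow> coeff (jacobi_as_poly n r) i = 0"
    by (simp add: jacobi_as_poly_def coeff_sum coeff_linear_power_eq_0)
  have 1: "coeff ([:1, -1:] ^ n) n = (-1 :: complex) ^ n"
    using lead_coeff_power[of "[:1, -1 :: complex:]" n] by (simp add: degree_power_eq)
  have nz: "pochhammer (r + 1 / 2) n \<noteq> 0" using assms by (intro pochhammer_nonzero_if_Re_pos) simp
  have "coeff (jacobi_as_poly n r) n =
      (pochhammer (r + 1 / 2) n / fact n) * (pochhammer (- of_nat n) n * pochhammer (of_nat n + r) n /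
        (pochhammer (r + 1 / 2) n * fact n)) / 2 ^ n * (- 1) ^ n"
    unfolding jacobi_as_poly_def coeff_sum gchoose_eq_pochhammer_half
    by (subst sum.remove[of _ n]) (auto simp: 1 coeff_linear_power_eq_0)
  also have "pochhammer (- of_nat n :: complex) n = (- 1) ^ n * fact n"
    by (rule pochhammer_same)
  also have "(pochhammer (r + 1 / 2) n / fact n) * ((- 1) ^ n * fact n * pochhammer (of_nat n + r) n /
        (pochhammer (r + 1 / 2) n * fact n)) / 2 ^ n * (- 1) ^ n = jacobi_lead n r"
  proof -
    have "A / f * (e * f * p / (A * f)) / t * e = p / (f * t)" if "A \<noteq> 0" "f \<noteq> 0" "e * e = 1" for A f e p t :: complex
      using that by (simp add: field_simps)
    then show ?thesis unfolding jacobi_lead_def using nz by (simp flip: power_add)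
  qed
  finally show "coeff (jacobi_as_poly n r) n = jacobi_lead n r" .
qed

lemma jacobi_lead_eq_Gamma:
  assumes "Re r > 0"
  shows "jacobi_lead n r = Gamma (2 * of_nat n + r) / (fact n * 2 ^ n * Gamma (of_nat n + r))"
    and "jacobi_lead n r \<noteq> 0"
proof -
  have "of_nat n + r \<notin> \<int>\<^sub>\<le>\<^sub>0" using assms by (intro Re_pos_not_nonpos_Int) simp
  then show "jacobi_lead n r = Gamma (2 * of_nat n + r) / (fact n * 2 ^ n * Gamma (of_nat n + r))"
    by (simp add: jacobi_lead_def pochhammer_Gamma add_ac)
  have "pochhammer (of_nat n + r) n \<noteq> 0" using assms by (intro pochhammer_nonzero_if_Re_pos) simp
  then show "jacobi_lead n r \<noteq> 0" by (simp add: jacobi_lead_def)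
qed

text \<open>
  Testing against powers of \<open>1 + x\<close> instead of \<open>x\<close> makes the sum a Chu-Vandermonde sum; its numerator
  \<open>pochhammer (m + 1 - n) n\<close> vanishes for \<open>m < n\<close>.
\<close>

lemma jacobi_functional_jacobi_as_poly:
  assumes r: "Re r > 0"
  shows "jacobi_functional r (jacobi_as_poly n r * [:1, 1:] ^ m) =
    pochhammer (r + 1 / 2) n / fact n * (2 powr (r + of_nat m) * Gamma (r + 1 / 2) * Gamma (of_nat m + 1 / 2) / Gamma (r + of_nat m + 1)) *
    (pochhammer (of_nat m + 1 - of_nat n) n / pochhammer (r + of_nat m + 1) n)"
proof -
  define B where "B = pochhammer (r + 1 / 2) n / fact n"
  define c where "c = r + of_nat m + 1"
  have Rc: "Re c > 0" "Re (r + 1 / 2) > 0" using r by (simp_all add: c_def)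
  \<comment> \<open>The factor \<open>pochhammer (r + 1 / 2) k\<close> cancels the one in the
    denominator of the Jacobi sum. What remains is a terminating Gauss series at argument 1.\<close>
  have term_eq: "jacobi_functional r ([:1, -1:] ^ k * [:1, 1:] ^ m) =
     2 ^ k * (pochhammer (r + 1 / 2) k / pochhammer c k) *
     (2 powr (r + of_nat m) * Gamma (r + 1 / 2) * Gamma (of_nat m + 1 / 2) / Gamma c)" for k
  proof -
    have "Gamma (r + of_nat k + 1 / 2) = pochhammer (r + 1 / 2) k * Gamma (r + 1 / 2)"
      using pochhammer_Gamma[OF Re_pos_not_nonpos_Int[OF Rc(2)], of k] Gamma_eq_zero_iff[of "r + 1 / 2"] Re_pos_not_nonpos_Int[OF Rc(2)]
      by (simp add: field_simps add_ac)
    moreover have "Gamma (r + of_nat k + of_nat m + 1) = pochhammer c k * Gamma c"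
      using pochhammer_Gamma[OF Re_pos_not_nonpos_Int[OF Rc(1)], of k] Gamma_eq_zero_iff[of c] Re_pos_not_nonpos_Int[OF Rc(1)]
      by (simp add: c_def add_ac)
    moreover have "2 powr (r + of_nat k + of_nat m) = 2 ^ k * 2 powr (r + of_nat m)"
      using of_real_powr_plus_of_nat[of 2 "r + of_nat m" k] by (simp add: add_ac)
    ultimately show ?thesis
      unfolding jacobi_functional_moment[OF r] by simp
  qed
  have nz: "pochhammer (r + 1 / 2) k \<noteq> 0" for k by (rule pochhammer_nonzero_if_Re_pos[OF Rc(2)])
  have "jacobi_functional r (jacobi_as_poly n r * [:1, 1:] ^ m) =
    (\<Sum>k\<le>n. B * (pochhammer (- of_nat n) k * pochhammer (of_nat n + r) k / (pochhammer (r + 1 / 2) k * fact k)) / 2 ^ k *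
       jacobi_functional r ([:1, -1:] ^ k * [:1, 1:] ^ m))"
    unfolding jacobi_as_poly_def sum_distrib_right gchoose_eq_pochhammer_half B_def
    by (simp only: jacobi_functional_sum[OF r] mult_smult_left jacobi_functional_smult)
  also have "\<dots> = (\<Sum>k\<le>n. B * (2 powr (r + of_nat m) * Gamma (r + 1 / 2) * Gamma (of_nat m + 1 / 2) / Gamma c) *
      (pochhammer (of_nat n + r) k * pochhammer (- of_nat n) k / (of_nat (fact k) * pochhammer c k)))"
  proof (rule sum.cong[OF refl])
    fix k
    have "B * (a * b / (p * f)) / t * (t * (p / d) * Z) = B * Z * (b * a / (f * d))" if "p \<noteq> 0" "t \<noteq> 0" for a b p f t d Z
      using that by simp
    note gen = this
    have "(2 :: complex) ^ k \<noteq> 0" by simp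
    then show "B * (pochhammer (- of_nat n) k * pochhammer (of_nat n + r) k / (pochhammer (r + 1 / 2) k * fact k)) / 2 ^ k *
       jacobi_functional r ([:1, -1:] ^ k * [:1, 1:] ^ m) =
      B * (2 powr (r + of_nat m) * Gamma (r + 1 / 2) * Gamma (of_nat m + 1 / 2) / Gamma c) *
      (pochhammer (of_nat n + r) k * pochhammer (- of_nat n) k / (of_nat (fact k) * pochhammer c k))"
      unfolding term_eq of_nat_fact by (rule gen[OF nz])
  qed
  also have "\<dots> = B * (2 powr (r + of_nat m) * Gamma (r + 1 / 2) * Gamma (of_nat m + 1 / 2) / Gamma c) *
      (pochhammer (c - (of_nat n + r)) n / pochhammer c n)"
  proof -
    have "\<forall>i\<in>{0..<n}. c \<noteq> - of_nat i" using Rc by auto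
    from Vandermonde_pochhammer[OF this] show ?thesis
      by (simp only: sum_distrib_left[symmetric] atLeast0AtMost)
  qed
  also have "c - (of_nat n + r) = of_nat m + 1 - of_nat n" by (simp add: c_def)
  finally show ?thesis by (simp only: B_def c_def)
qed

definition monic_jacobi :: "complex \<Rightarrow> nat \<Rightarrow> complex poly" where
  "monic_jacobi r n = Polynomial.smult (1 / jacobi_lead n r) (jacobi_as_poly n r)"

text \<open>Szego's normalization constant divided by the square of the leading coefficient.\<close>

definition jacobi_norm :: "complex \<Rightarrow> nat \<Rightarrow> complex" where
  "jacobi_norm r n = 2 powr (r + of_nat n) * Gamma (of_nat n + 1 / 2) * Gamma (r + of_nat n + 1 / 2) /
     (jacobi_lead n r * Gamma (r + 2 * of_nat n + 1))"

text \<open>Everything follows from the pairings with powers of \<open>1 + x\<close>: those below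
  \<open>n\<close> vanish and span the lower degrees, and the one with \<open>(1 + x) ^ n\<close> is
  the norm.\<close>

lemma monic_orthogonal_jacobi:
  assumes r: "Re r > 0"
  shows "monic_orthogonal (jacobi_functional r) (monic_jacobi r) (jacobi_norm r)"
proof -
  have lead: "coeff (monic_jacobi r n) n = 1" for n
    using coeff_jacobi_as_poly(2)[OF r] jacobi_lead_eq_Gamma(2)[OF r] by (simp add: monic_jacobi_def)
  have high: "coeff (monic_jacobi r n) i = 0" if "i > n" for n i
    using coeff_jacobi_as_poly(1)[OF r that] by (simp add: monic_jacobi_def)
  have deg: "degree (monic_jacobi r n) = n" for n
    using high lead by (metis degree_le le_antisym le_degree zero_neq_one)
  have e: "degree ([:1, 1 :: complex:] ^ m) = m \<and> coeff ([:1, 1 :: complex:] ^ m) m = 1" for m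
  proof -
    have "degree ([:1, 1 :: complex:] ^ m) = m" using degree_power_eq[of "[:1, 1 :: complex:]" m] by simp
    then show ?thesis using lead_coeff_power[of "[:1, 1 :: complex:]" m] by simp
  qed
  have low: "jacobi_functional r (monic_jacobi r n * q) = 0" if "\<And>i. i \<ge> n \<Longrightarrow> coeff q i = 0" for n q
  proof (rule coeff_bound_monic_induct[where e = "\<lambda>m. [:1, 1:] ^ m", OF e that])
    show "jacobi_functional r (monic_jacobi r n * 0) = 0" by (simp add: jacobi_functional_def)
    fix c m q assume m: "m < n" and q: "jacobi_functional r (monic_jacobi r n * q) = 0"
    \<comment> \<open>The vanishing factor is the one of index \<open>n - 1 - m\<close>, which lies
      below \<open>n\<close> exactly because \<open>m < n\<close>.\<close>
    have "pochhammer (of_nat m + 1 - of_nat n :: complex) n = 0"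
      unfolding pochhammer_eq_0_iff using m by (intro exI[of _ "n - 1 - m"]) (simp add: of_nat_diff)
    then have "jacobi_functional r (monic_jacobi r n * [:1, 1:] ^ m) = 0"
      unfolding monic_jacobi_def mult_smult_left jacobi_functional_smult jacobi_functional_jacobi_as_poly[OF r]
      by simp
    then show "jacobi_functional r (monic_jacobi r n * (Polynomial.smult c ([:1, 1:] ^ m) + q)) = 0"
      using q by (simp add: distrib_left jacobi_functional_add[OF r] jacobi_functional_smult)
  qed
  show ?thesis
  proof
    show "jacobi_functional r (q + q') = jacobi_functional r q + jacobi_functional r q'" for q q'
      by (rule jacobi_functional_add[OF r])
    show "jacobi_functional r (Polynomial.smult c q) = c * jacobi_functional r q" for c q
      by (rule jacobi_functional_smult)
    show "degree (monic_jacobi r n) = n" for n by (rule deg)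
    show "coeff (monic_jacobi r n) n = 1" for n by (rule lead)
    show "jacobi_functional r (monic_jacobi r m * monic_jacobi r n) = 0" if "m \<noteq> n" for m n
    proof (cases "m < n")
      case True
      then show ?thesis by (subst mult.commute, intro low) (auto simp: high)
    next
      case False
      then show ?thesis using that by (intro low) (auto simp: high)
    qed
    show "jacobi_functional r (monic_jacobi r n * monic_jacobi r n) = jacobi_norm r n" for n
    proof -
      \<comment> \<open>Both polynomials in the difference are monic of degree \<open>n\<close>, so
        one factor of the square may be replaced by \<open>(1 + x) ^ n\<close>.\<close>
      have "jacobi_functional r (monic_jacobi r n * (monic_jacobi r n - [:1, 1:] ^ n)) = 0"
      proof (rule low)
        fix i assume "i \<ge> n"
        then show "coeff (monic_jacobi r n - [:1, 1:] ^ n) i = 0"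
          using lead[of n] e[of n] by (cases "i = n") (auto simp: high coeff_linear_power_eq_0)
      qed
      then have "jacobi_functional r (monic_jacobi r n * monic_jacobi r n) = jacobi_functional r (monic_jacobi r n * [:1, 1:] ^ n)"
        using jacobi_functional_add[OF r, of "monic_jacobi r n * (monic_jacobi r n - [:1, 1:] ^ n)" "monic_jacobi r n * [:1, 1:] ^ n"]
        by (simp add: right_diff_distrib)
      also have "\<dots> = 1 / jacobi_lead n r * (pochhammer (r + 1 / 2) n / fact n * (2 powr (r + of_nat n) * Gamma (r + 1 / 2) * Gamma (of_nat n + 1 / 2) / Gamma (r + of_nat n + 1)) *
    (pochhammer 1 n / pochhammer (r + of_nat n + 1) n))"
        unfolding monic_jacobi_def mult_smult_left jacobi_functional_smult jacobi_functional_jacobi_as_poly[OF r]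
        by simp
      also have "\<dots> = jacobi_norm r n"
      proof -
        have a: "pochhammer (r + 1 / 2) n = Gamma (r + of_nat n + 1 / 2) / Gamma (r + 1 / 2)"
          using r by (subst pochhammer_Gamma) (auto intro!: Re_pos_not_nonpos_Int simp: add_ac)
        have b: "pochhammer (r + of_nat n + 1) n = Gamma (r + 2 * of_nat n + 1) / Gamma (r + of_nat n + 1)"
          using r by (subst pochhammer_Gamma) (auto intro!: Re_pos_not_nonpos_Int simp: add_ac)
        have nz: "Gamma (r + 1 / 2) \<noteq> 0" "Gamma (r + of_nat n + 1) \<noteq> 0"
          using r by (simp_all add: Gamma_eq_zero_iff Re_pos_not_nonpos_Int)
        have "1 / l * (G1 / G2 / f * (w * G2 * H / G3) * (f / (G4 / G3))) = w * H * G1 / (l * G4)"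
          if "G2 \<noteq> 0" "G3 \<noteq> 0" "f \<noteq> 0" for l G1 G2 f w H G3 G4 :: complex
          using that by (simp add: field_simps)
        from this[OF nz, of "fact n"] show ?thesis
          unfolding a b jacobi_norm_def by (simp add: pochhammer_fact[symmetric])
      qed
      finally show ?thesis .
    qed
    show "jacobi_norm r n \<noteq> 0" for n
      using r jacobi_lead_eq_Gamma(2)[OF r] by (simp add: jacobi_norm_def Gamma_eq_zero_iff Re_pos_not_nonpos_Int)
  qed
qed

section \<open>The product of the norms and the kernel on the diagonal\<close>

text \<open>The factorial is absorbed by the values \<open>Gamma (2 + j) = (j + 1)!\<close>: each
  norm supplies only \<open>j!\<close>, and \<open>N!\<close> supplies the remaining factors
  \<open>j + 1\<close>.\<close>

lemma fact_mult_prod_jacobi_norm: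
  assumes r: "Re r > 0"
  shows "fact N * (\<Prod>j<N. jacobi_norm r j) =
    2 powr (of_nat N * r + of_nat (N\<^sup>2) - of_nat N) *
    (\<Prod>j\<in>{0..<N}. Gamma (2 + of_nat j) * Gamma (1 / 2 + of_nat j) * Gamma (r + 1 / 2 + of_nat j)
                     / Gamma (r + of_nat N + of_nat j))"
proof (induction N)
  case (Suc N)
  define Q where "Q N = (\<Prod>j\<in>{0..<N}. Gamma (2 + of_nat j) * Gamma (1 / 2 + of_nat j) * Gamma (r + 1 / 2 + of_nat j))" for N :: nat
  \<comment> \<open>In the denominator \<open>N\<close> enters both as the offset and as the number
    of factors, so the induction step changes every factor. With the two separated, raising the
    offset only exchanges the first factor for a new last one.\<close>
  define R where "R M N = (\<Prod>j\<in>{0..<N}. Gamma (r + of_nat M + of_nat j))" for M N :: nat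
  have split: "(\<Prod>j\<in>{0..<N}. Gamma (2 + of_nat j) * Gamma (1 / 2 + of_nat j) * Gamma (r + 1 / 2 + of_nat j)
                     / Gamma (r + of_nat N + of_nat j)) = Q N / R N N" for N
    by (simp add: Q_def R_def prod_dividef)
  have GN: "Gamma (r + of_nat j) \<noteq> 0" for j
    using r by (simp add: Gamma_eq_zero_iff Re_pos_not_nonpos_Int)
  have Rnz: "R M N \<noteq> 0" for M N
    using GN[of "M + j" for j] by (simp add: R_def add_ac)
  have R1: "R N (Suc N) = Gamma (r + of_nat N) * R (Suc N) N"
    unfolding R_def by (subst prod.atLeast0_lessThan_Suc_shift) (simp add: add_ac o_def)
  have R2: "R N (Suc N) = R N N * Gamma (r + 2 * of_nat N)" by (simp add: R_def add_ac)
  have R3: "R (Suc N) (Suc N) = R (Suc N) N * Gamma (r + 2 * of_nat N + 1)" by (simp add: R_def add_ac)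
  have norm: "jacobi_norm r N = 2 powr (r + 2 * of_nat N) * fact N * Gamma (r + of_nat N) * Gamma (1 / 2 + of_nat N) * Gamma (r + 1 / 2 + of_nat N)
      / (Gamma (r + 2 * of_nat N) * Gamma (r + 2 * of_nat N + 1))"
  proof -
    have "2 powr (r + 2 * of_nat N) = 2 ^ N * 2 powr (r + of_nat N)"
      using of_real_powr_plus_of_nat[of 2 "r + of_nat N" N] by (simp add: add_ac)
    then show ?thesis
      unfolding jacobi_norm_def jacobi_lead_eq_Gamma(1)[OF r] by (simp add: add_ac)
  qed
  have Q: "Q (Suc N) = Q N * (fact (Suc N) * Gamma (1 / 2 + of_nat N) * Gamma (r + 1 / 2 + of_nat N))"
    using Gamma_fact[of "Suc N", where 'a = complex] by (simp add: Q_def add_ac)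
  have pw: "2 powr (of_nat (Suc N) * r + of_nat ((Suc N)\<^sup>2) - of_nat (Suc N)) =
      2 powr (of_nat N * r + of_nat (N\<^sup>2) - of_nat N) * 2 powr (r + 2 * of_nat N :: complex)"
    by (simp add: power2_eq_square algebra_simps flip: powr_add)
  have "fact (Suc N) * (\<Prod>j<Suc N. jacobi_norm r j) =
      of_nat (Suc N) * (fact N * (\<Prod>j<N. jacobi_norm r j)) * jacobi_norm r N"
    by (simp add: algebra_simps)
  also have "\<dots> = 2 powr (of_nat (Suc N) * r + of_nat ((Suc N)\<^sup>2) - of_nat (Suc N)) * (Q (Suc N) / R (Suc N) (Suc N))"
  proof -
    have q: "R (Suc N) N = R N N * Gamma (r + 2 * of_nat N) / Gamma (r + of_nat N)"
      using R1 R2 GN[of N] by (simp add: field_simps)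
    have gen: "k * (p * (Q / R)) * (w * f * G * H * I / (D * E)) = p * w * (Q * (k * f * H * I) / (R * D / G * E))"
      if "G \<noteq> 0" for k p Q R w f G H I D E :: complex
      using that by (simp add: mult_ac)
    show ?thesis
      unfolding Suc.IH split norm Q R3 q pw fact_Suc using gen[OF GN[of N]] by simp
  qed
  finally show ?case unfolding split .
qed simp

lemma jacobi_wronskian_eq:
  assumes r: "Re r > 0"
  shows "jacobi_wronskian (Suc n) r \<theta> = jacobi_lead (Suc n) r * jacobi_lead n r *
     (poly (pderiv (monic_jacobi r (n + 1))) (of_real (cos \<theta>)) * poly (monic_jacobi r n) (of_real (cos \<theta>)) -
      poly (monic_jacobi r (n + 1)) (of_real (cos \<theta>)) * poly (pderiv (monic_jacobi r n)) (of_real (cos \<theta>)))"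
proof -
  have "jacobi_poly n (r - 1 / 2) (- 1 / 2) = poly (jacobi_as_poly n r)" for n
    by (rule ext) (rule jacobi_poly_eq_poly)
  moreover have "deriv (poly q) x = poly (pderiv q) x" for q and x :: complex
    by (rule DERIV_imp_deriv) (rule poly_DERIV)
  ultimately have "jacobi_wronskian (Suc n) r \<theta> =
    poly (pderiv (jacobi_as_poly (Suc n) r)) (of_real (cos \<theta>)) * poly (jacobi_as_poly n r) (of_real (cos \<theta>)) -
    poly (jacobi_as_poly (Suc n) r) (of_real (cos \<theta>)) * poly (pderiv (jacobi_as_poly n r)) (of_real (cos \<theta>))"
    by (simp add: jacobi_wronskian_def Let_def)
  moreover have "jacobi_as_poly m r = Polynomial.smult (jacobi_lead m r) (monic_jacobi r m)" for m
    using jacobi_lead_eq_Gamma(2)[OF r] by (simp add: monic_jacobi_def)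
  ultimately show ?thesis by (simp add: pderiv_smult algebra_simps)
qed

text \<open>Christoffel-Darboux for the monic polynomials, rescaled by both leading coefficients.
  \<open>jacobi_lead n r\<close> cancels against the norm, and \<open>jacobi_lead (Suc n) r\<close>
  contains \<open>Gamma (s + 1) = s * Gamma s\<close>, which cancels \<open>Gamma s\<close> and
  leaves the denominator \<open>s = 2 N + r - 1\<close> for \<open>N = n + 1\<close>.\<close>

lemma jacobi_kernel_eq:
  assumes r: "Re r > 0"
  shows "(\<Sum>j\<le>n. poly (monic_jacobi r j) (of_real (cos \<theta>)) ^ 2 / jacobi_norm r j) =
    2 powr (1 - r) / (2 * of_nat (Suc n) + r - 1) *
     (Gamma (of_nat (Suc n) + 1) * Gamma (of_nat (Suc n) + r)
        / (Gamma (of_nat (Suc n) + r - 1 / 2) * Gamma (of_nat (Suc n) - 1 / 2))) *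
     jacobi_wronskian (Suc n) r \<theta>"
proof -
  interpret monic_orthogonal "jacobi_functional r" "monic_jacobi r" "jacobi_norm r"
    by (rule monic_orthogonal_jacobi[OF r])
  define W where "W = poly (pderiv (monic_jacobi r (n + 1))) (of_real (cos \<theta>)) * poly (monic_jacobi r n) (of_real (cos \<theta>)) -
      poly (monic_jacobi r (n + 1)) (of_real (cos \<theta>)) * poly (pderiv (monic_jacobi r n)) (of_real (cos \<theta>))"
  define s where "s = r + 2 * of_nat n + 1"
  have Re: "Re s > 0" using r by (simp add: s_def)
  have nz: "Gamma s \<noteq> 0" "Gamma (of_nat (Suc n) + r) \<noteq> 0" "Gamma (of_nat n + 1 / 2 :: complex) \<noteq> 0" "Gamma (r + of_nat n + 1 / 2) \<noteq> 0" "s \<noteq> 0"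
    using r Re by (auto simp: Gamma_eq_zero_iff Re_pos_not_nonpos_Int)
  have Gs: "Gamma (s + 1) = s * Gamma s" using Re by (simp add: Gamma_plus1 Re_pos_not_nonpos_Int)
  have l1: "jacobi_lead (Suc n) r = s * Gamma s / (fact (Suc n) * 2 ^ Suc n * Gamma (of_nat (Suc n) + r))"
  proof -
    have "2 * of_nat (Suc n) + r = s + 1" by (simp add: s_def)
    then show ?thesis unfolding jacobi_lead_eq_Gamma(1)[OF r] Gs[symmetric] by (simp only:)
  qed
  have h: "jacobi_norm r n = 2 powr (r + of_nat n) * Gamma (of_nat n + 1 / 2) * Gamma (r + of_nat n + 1 / 2) / (jacobi_lead n r * Gamma s)"
    by (simp add: jacobi_norm_def s_def)
  have pw: "2 powr (1 - r) * 2 powr (r + of_nat n) = (2 :: complex) ^ Suc n"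
  proof -
    have "2 powr (1 - r) * 2 powr (r + of_nat n) = 2 powr (of_nat (Suc n) :: complex)"
      by (simp flip: powr_add)
    also have "\<dots> = 2 ^ Suc n" by (rule powr_nat') simp
    finally show ?thesis .
  qed
  have "(\<Sum>j\<le>n. poly (monic_jacobi r j) (of_real (cos \<theta>)) ^ 2 / jacobi_norm r j) = W / jacobi_norm r n"
    unfolding W_def by (rule christoffel_darboux)
  also have "\<dots> = 2 powr (1 - r) / s * (fact (Suc n) * Gamma (of_nat (Suc n) + r)
        / (Gamma (r + of_nat n + 1 / 2) * Gamma (of_nat n + 1 / 2))) * (jacobi_lead (Suc n) r * jacobi_lead n r * W)"
  proof -
    have gen: "W / (w * H * I / (l * S)) = z / s * (f * G / (I * H)) * (s * S / (f * (z * w) * G) * l * W)"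
      if "w \<noteq> 0" "z \<noteq> 0" "H \<noteq> 0" "I \<noteq> 0" "S \<noteq> 0" "s \<noteq> 0" "f \<noteq> 0" "G \<noteq> 0" for W w H I l S z s f G :: complex
      using that by (simp add: field_simps)
    show ?thesis
      unfolding h l1 pw[symmetric] by (rule gen) (use nz in \<open>simp_all del: fact_Suc of_nat_Suc\<close>)
  qed
  also have "fact (Suc n) = Gamma (of_nat (Suc n) + 1 :: complex)"
    using Gamma_fact[of "Suc n", where 'a = complex] by (simp add: add_ac)
  also have "s = 2 * of_nat (Suc n) + r - 1" by (simp add: s_def)
  also have "r + of_nat n + 1 / 2 = of_nat (Suc n) + r - 1 / 2" by simp
  also have "of_nat n + 1 / 2 = (of_nat (Suc n) - 1 / 2 :: complex)" by simp
  finally show ?thesis unfolding jacobi_wronskian_eq[OF r] W_def .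
qed

section \<open>Integration over the eigenangles\<close>

text \<open>Each permutation is a transposition of 0 with its image, composed with one of the
  \<open>n!\<close> permutations that fix 0.\<close>

lemma sum_permutes_apply_0:
  fixes f :: "nat \<Rightarrow> 'a::field_char_0"
  shows "(\<Sum>\<sigma> | \<sigma> permutes {..<Suc n}. f (\<sigma> 0)) = fact n * (\<Sum>j<Suc n. f j)"
proof -
  have ins: "{..<Suc n} = insert 0 {1..n}" by auto
  have "(\<Sum>\<sigma> | \<sigma> permutes insert 0 {1..n}. f (\<sigma> 0)) =
    (\<Sum>b\<in>insert 0 {1..n}. \<Sum>q | q permutes {1..n}. f ((Transposition.transpose 0 b \<circ> q) 0))"
    by (rule sum_over_permutations_insert) auto
  also have "\<dots> = (\<Sum>b\<in>insert 0 {1..n}. \<Sum>q | q permutes {1..n}. f b)"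
    by (intro sum.cong refl) (simp add: permutes_not_in)
  also have "\<dots> = fact n * (\<Sum>b\<in>insert 0 {1..n}. f b)"
  proof -
    have "card {q. q permutes {1..n}} = fact n" by (rule card_permutations) auto
    then show ?thesis by (simp only: sum_constant of_nat_fact sum_distrib_left)
  qed
  finally show ?thesis unfolding ins .
qed

text \<open>Position 0 belongs to the angle that is held fixed. Orthogonality at the other
  \<open>n\<close> positions leaves only \<open>\<tau> = \<sigma>\<close>, which contributes the
  full product of norms with the factor \<open>h (\<sigma> 0)\<close> missing; summing over
  \<open>\<sigma>\<close> gives the kernel.\<close>

lemma (in monic_orthogonal) sum_permutes_orthogonal:
  "(\<Sum>\<sigma> | \<sigma> permutes {..<Suc n}. \<Sum>\<tau> | \<tau> permutes {..<Suc n}. of_int (sign \<sigma>) * of_int (sign \<tau>) *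
      (poly (p (\<sigma> 0)) x * poly (p (\<tau> 0)) x) * (\<Prod>i\<in>{1..n}. L (p (\<sigma> i) * p (\<tau> i)))) =
    fact n * (\<Prod>j<Suc n. h j) * (\<Sum>j\<le>n. poly (p j) x ^ 2 / h j)"
proof -
  have ins: "{..<Suc n} = insert 0 {1..n}" by auto
  have fin: "finite {\<sigma>. \<sigma> permutes {..<Suc n}}" by (rule finite_permutations) simp
  have inner: "(\<Sum>\<tau> | \<tau> permutes {..<Suc n}. of_int (sign \<sigma>) * of_int (sign \<tau>) *
      (poly (p (\<sigma> 0)) x * poly (p (\<tau> 0)) x) * (\<Prod>i\<in>{1..n}. L (p (\<sigma> i) * p (\<tau> i)))) =
      (\<Prod>j<Suc n. h j) * (poly (p (\<sigma> 0)) x ^ 2 / h (\<sigma> 0))"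
    if \<sigma>: "\<sigma> permutes {..<Suc n}" for \<sigma>
  proof -
    have "(\<Sum>\<tau> | \<tau> permutes {..<Suc n}. of_int (sign \<sigma>) * of_int (sign \<tau>) *
      (poly (p (\<sigma> 0)) x * poly (p (\<tau> 0)) x) * (\<Prod>i\<in>{1..n}. L (p (\<sigma> i) * p (\<tau> i)))) =
      of_int (sign \<sigma>) * of_int (sign \<sigma>) *
      (poly (p (\<sigma> 0)) x * poly (p (\<sigma> 0)) x) * (\<Prod>i\<in>{1..n}. L (p (\<sigma> i) * p (\<sigma> i)))"
    proof (rule sum.remove[OF fin, THEN trans])
      show "\<sigma> \<in> {\<sigma>. \<sigma> permutes {..<Suc n}}" using \<sigma> by simp
      have "(\<Prod>i\<in>{1..n}. L (p (\<sigma> i) * p (\<tau> i))) = 0" if \<tau>: "\<tau> permutes {..<Suc n}" "\<tau> \<noteq> \<sigma>" for \<tau>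
      proof -
        \<comment> \<open>Permutations that agree on \<open>1..n\<close> are left with the same
          single value at 0, so they are equal.\<close>
        have "\<exists>i\<in>{1..n}. \<sigma> i \<noteq> \<tau> i"
        proof (rule ccontr)
          assume "\<not> ?thesis"
          then have eq: "\<sigma> i = \<tau> i" if "i \<in> {1..n}" for i using that by blast
          have "\<sigma> ` insert 0 {1..n} = insert 0 {1..n}" "\<tau> ` insert 0 {1..n} = insert 0 {1..n}"
            using permutes_image[OF \<sigma>] permutes_image[OF \<tau>(1)] by (simp_all only: ins)
          moreover have "\<sigma> ` {1..n} = \<tau> ` {1..n}" using eq by (intro image_cong) auto
          moreover have "\<sigma> 0 \<notin> \<sigma> ` {1..n}" "\<tau> 0 \<notin> \<tau> ` {1..n}"
            using permutes_inj[OF \<sigma>] permutes_inj[OF \<tau>(1)] by (auto simp: inj_eq)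
          ultimately have "\<sigma> 0 = \<tau> 0" by (metis image_insert insert_ident insert_iff insertE)
          then have "\<sigma> i = \<tau> i" for i
            using eq[of i] permutes_not_in[OF \<sigma>, of i] permutes_not_in[OF \<tau>(1), of i]
            by (cases "i = 0"; cases "i \<in> {1..n}") auto
          then show False using \<tau> by auto
        qed
        then show ?thesis using orth by (intro prod_zero) auto
      qed
      then have "(\<Sum>\<tau>\<in>{\<tau>. \<tau> permutes {..<Suc n}} - {\<sigma>}. of_int (sign \<sigma>) * of_int (sign \<tau>) *
      (poly (p (\<sigma> 0)) x * poly (p (\<tau> 0)) x) * (\<Prod>i\<in>{1..n}. L (p (\<sigma> i) * p (\<tau> i)))) = 0"
        by (intro sum.neutral ballI) simp
      then show "of_int (sign \<sigma>) * of_int (sign \<sigma>) *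
      (poly (p (\<sigma> 0)) x * poly (p (\<sigma> 0)) x) * (\<Prod>i\<in>{1..n}. L (p (\<sigma> i) * p (\<sigma> i))) +
      (\<Sum>\<tau>\<in>{\<tau>. \<tau> permutes {..<Suc n}} - {\<sigma>}. of_int (sign \<sigma>) * of_int (sign \<tau>) *
      (poly (p (\<sigma> 0)) x * poly (p (\<tau> 0)) x) * (\<Prod>i\<in>{1..n}. L (p (\<sigma> i) * p (\<tau> i)))) =
      of_int (sign \<sigma>) * of_int (sign \<sigma>) *
      (poly (p (\<sigma> 0)) x * poly (p (\<sigma> 0)) x) * (\<Prod>i\<in>{1..n}. L (p (\<sigma> i) * p (\<sigma> i)))"
        by (simp only: add_0_right)
    qed
    also have "of_int (sign \<sigma>) * of_int (sign \<sigma>) = (1 :: 'a)"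
      by (simp add: sign_def)
    also have "(\<Prod>i\<in>{1..n}. L (p (\<sigma> i) * p (\<sigma> i))) = (\<Prod>j<Suc n. h j) / h (\<sigma> 0)"
    proof -
      have "(\<Prod>j<Suc n. h j) = (\<Prod>i<Suc n. h (\<sigma> i))"
        using permutes_imp_bij[OF \<sigma>] by (rule prod.reindex_bij_betw[symmetric])
      also have "\<dots> = h (\<sigma> 0) * (\<Prod>i\<in>{1..n}. h (\<sigma> i))" unfolding ins by simp
      finally show ?thesis using norm_nz by (simp add: norm_p)
    qed
    finally show ?thesis by (simp add: power2_eq_square)
  qed
  have "(\<Sum>\<sigma> | \<sigma> permutes {..<Suc n}. \<Sum>\<tau> | \<tau> permutes {..<Suc n}. of_int (sign \<sigma>) * of_int (sign \<tau>) *
      (poly (p (\<sigma> 0)) x * poly (p (\<tau> 0)) x) * (\<Prod>i\<in>{1..n}. L (p (\<sigma> i) * p (\<tau> i)))) =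
    (\<Sum>\<sigma> | \<sigma> permutes {..<Suc n}. (\<Prod>j<Suc n. h j) * (poly (p (\<sigma> 0)) x ^ 2 / h (\<sigma> 0)))"
    by (intro sum.cong refl inner) simp
  also have "\<dots> = fact n * (\<Sum>j<Suc n. (\<Prod>j<Suc n. h j) * (poly (p j) x ^ 2 / h j))"
    by (rule sum_permutes_apply_0)
  also have "\<dots> = fact n * (\<Prod>j<Suc n. h j) * (\<Sum>j\<le>n. poly (p j) x ^ 2 / h j)"
    by (simp only: sum_distrib_left[symmetric] lessThan_Suc_atMost mult.assoc)
  finally show ?thesis .
qed

section \<open>From the eigenangle integral to sums over pairs of permutations\<close>

lemma prod_of_real_powr:
  assumes "\<And>i. i \<in> A \<Longrightarrow> 0 \<le> a i"
  shows "complex_of_real (\<Prod>i\<in>A. a i) powr r = (\<Prod>i\<in>A. complex_of_real (a i) powr r)"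
  using assms
  by (induction A rule: infinite_finite_induct) (auto simp: powr_times_real prod_nonneg simp flip: of_real_prod)

lemma char_poly_at_one_powr:
  "complex_of_real (char_poly_at_one N \<theta>) powr r =
     2 powr (of_nat N * r) * (\<Prod>j\<in>{1..N}. complex_of_real (1 - cos (\<theta> j)) powr r)"
proof -
  have "complex_of_real (char_poly_at_one N \<theta>) powr r =
     complex_of_real (2 ^ N) powr r * complex_of_real (\<Prod>j\<in>{1..N}. 1 - cos (\<theta> j)) powr r"
    unfolding char_poly_at_one_def of_real_mult
    by (rule powr_times_real) (simp_all add: prod_nonneg del: of_real_prod of_real_power)
  also have "complex_of_real (\<Prod>j\<in>{1..N}. 1 - cos (\<theta> j)) powr r = (\<Prod>j\<in>{1..N}. complex_of_real (1 - cos (\<theta> j)) powr r)"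
    by (rule prod_of_real_powr) simp
  also have "complex_of_real (2 ^ N) powr r = 2 powr (of_nat N * r)"
  proof -
    have "2 powr (of_nat N * r) = (2 powr r) ^ N"
      by (induction N) (simp_all add: distrib_right powr_add)
    then show ?thesis using prod_of_real_powr[of "{..<N}" "\<lambda>_. 2" r] by simp
  qed
  finally show ?thesis .
qed

lemma prod_cos_diff_eq_vandermonde:
  "complex_of_real (\<Prod>k\<in>{1..N}. \<Prod>j\<in>{1..<k}. (cos (\<theta> j) - cos (\<theta> k))\<^sup>2) =
     (\<Prod>k<N. \<Prod>j<k. complex_of_real (cos (\<theta> (Suc k))) - of_real (cos (\<theta> (Suc j))))\<^sup>2"
proof -
  have inner: "(\<Prod>j\<in>{1..<Suc k}. f j) = (\<Prod>j<k. f (Suc j))" for f :: "nat \<Rightarrow> real" and k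
    by (simp add: prod.shift_bounds_Suc_ivl[of f 0 k, simplified] lessThan_atLeast0)
  have outer: "(\<Prod>k\<in>{1..N}. g k) = (\<Prod>k<N. g (Suc k))" for g :: "nat \<Rightarrow> real"
    by (simp add: prod.atLeast1_atMost_eq)
  have "(\<Prod>k\<in>{1..N}. \<Prod>j\<in>{1..<k}. (cos (\<theta> j) - cos (\<theta> k))\<^sup>2) =
    (\<Prod>k<N. \<Prod>j<k. (cos (\<theta> (Suc k)) - cos (\<theta> (Suc j)))\<^sup>2)"
    unfolding outer inner by (simp only: power2_commute)
  also have "complex_of_real \<dots> = (\<Prod>k<N. \<Prod>j<k. complex_of_real (cos (\<theta> (Suc k))) - of_real (cos (\<theta> (Suc j))))\<^sup>2"
    by (simp add: prod_power_distrib)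
  finally show ?thesis .
qed

lemma jacobi_weight_lborel:
  assumes r: "Re r > 0"
  shows "integrable lborel (\<lambda>t. indicator {0..pi} t *\<^sub>R (poly q (of_real (cos t)) * complex_of_real (1 - cos t) powr r))"
    and "(LINT t|lborel. indicator {0..pi} t *\<^sub>R (poly q (of_real (cos t)) * complex_of_real (1 - cos t) powr r)) =
      jacobi_functional r q"
proof -
  have *: "set_integrable lborel {0..pi} (\<lambda>t. poly q (of_real (cos t)) * complex_of_real (1 - cos t) powr r)"
    by (intro borel_integrable_atLeastAtMost' continuous_on_jacobi_weight r)
  then show "integrable lborel (\<lambda>t. indicator {0..pi} t *\<^sub>R (poly q (of_real (cos t)) * complex_of_real (1 - cos t) powr r))"
    by (simp add: set_integrable_def)
  show "(LINT t|lborel. indicator {0..pi} t *\<^sub>R (poly q (of_real (cos t)) * complex_of_real (1 - cos t) powr r)) =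
      jacobi_functional r q"
    using set_borel_integral_eq_integral(2)[OF *] by (simp add: set_lebesgue_integral_def jacobi_functional_def)
qed

text \<open>The two copies of the Vandermonde product in its square are expanded separately. Each
  pair of permutations then gives a product of functions of single angles, whose integral is a
  product of values of \<open>jacobi_functional\<close>.\<close>

lemma integral_eigenangles:
  fixes t :: real and n :: nat
  assumes r: "Re r > 0"
  defines "N \<equiv> Suc n" and "M \<equiv> (\<Pi>\<^sub>M j\<in>{2..Suc n}. (lborel :: real measure))"
  shows "(LINT v|M. indicator (\<Pi>\<^sub>E j\<in>{2..N}. {0..pi}) v *\<^sub>R
      (complex_of_real (\<Prod>k\<in>{1..N}. \<Prod>j\<in>{1..<k}. (cos ((v(1 := t)) j) - cos ((v(1 := t)) k))\<^sup>2) *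
       complex_of_real (char_poly_at_one N (v(1 := t))) powr r)) =
    fact n * (\<Prod>j<N. jacobi_norm r j) * (\<Sum>j\<le>n. poly (monic_jacobi r j) (of_real (cos t)) ^ 2 / jacobi_norm r j) *
      2 powr (of_nat N * r) * complex_of_real (1 - cos t) powr r"
proof -
  interpret monic_orthogonal "jacobi_functional r" "monic_jacobi r" "jacobi_norm r"
    by (rule monic_orthogonal_jacobi[OF r])
  interpret product_sigma_finite "\<lambda>_::nat. lborel :: real measure"
    by standard
  define x where "x = complex_of_real (cos t)"
  define W where "W = 2 powr (of_nat N * r) * complex_of_real (1 - cos t) powr r"
  define P where "P = {\<sigma>. \<sigma> permutes {..<N}}"
  have finP: "finite P" unfolding P_def by (rule finite_permutations) simp
  \<comment> \<open>Each one-angle factor carries its share of the indicator of the box, so that the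
    integral over the whole product space factorizes.\<close>
  define \<phi> where "\<phi> q y = indicator {0..pi} y *\<^sub>R (poly q (of_real (cos y)) * complex_of_real (1 - cos y) powr r)" for q y
  define c where "c \<sigma> \<tau> = W * (of_int (sign \<sigma>) * of_int (sign \<tau>) * (poly (monic_jacobi r (\<sigma> 0)) x * poly (monic_jacobi r (\<tau> 0)) x))"
    for \<sigma> \<tau> :: "nat \<Rightarrow> nat"
  \<comment> \<open>Angles are numbered from 1 and positions in a permutation from 0: angle
    \<open>k\<close> sits at position \<open>k - 1\<close>, and position 0 is the fixed
    angle.\<close>
  have shift: "(\<Prod>i<N. G i) = G 0 * (\<Prod>k\<in>{2..Suc n}. G (k - 1))" for G :: "nat \<Rightarrow> complex"
  proof -
    have "(\<Prod>k\<in>{2..Suc n}. G (k - 1)) = (\<Prod>i\<in>{1..n}. G i)"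
      by (rule prod.reindex_bij_witness[of _ Suc "\<lambda>k. k - 1"]) auto
    moreover have "{..<N} = insert 0 {1..n}" unfolding N_def by auto
    ultimately show ?thesis by simp
  qed
  have expand: "indicator (\<Pi>\<^sub>E j\<in>{2..N}. {0..pi}) v *\<^sub>R
      (complex_of_real (\<Prod>k\<in>{1..N}. \<Prod>j\<in>{1..<k}. (cos ((v(1 := t)) j) - cos ((v(1 := t)) k))\<^sup>2) *
       complex_of_real (char_poly_at_one N (v(1 := t))) powr r) =
     (\<Sum>\<sigma>\<in>P. \<Sum>\<tau>\<in>P. c \<sigma> \<tau> * (\<Prod>k\<in>{2..Suc n}. \<phi> (monic_jacobi r (\<sigma> (k - 1)) * monic_jacobi r (\<tau> (k - 1))) (v k)))"
    if v: "v \<in> space M" for v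
  proof -
    define z where "z i = complex_of_real (cos ((v(1 := t)) (Suc i)))" for i
    have z0: "z 0 = x" by (simp add: z_def x_def)
    have zk: "z (k - 1) = of_real (cos (v k))" if "k \<in> {2..Suc n}" for k
      using that by (auto simp: z_def)
    define I where "I = (indicator (\<Pi>\<^sub>E j\<in>{2..N}. {0..pi}) v :: complex)"
    \<comment> \<open>Membership in \<open>PiE\<close> also demands that \<open>v\<close> be
      undefined off the index set; \<open>v \<in> space M\<close> supplies this.\<close>
    have I: "I = (\<Prod>k\<in>{2..Suc n}. indicator {0..pi} (v k))"
    proof (cases "\<forall>k\<in>{2..Suc n}. v k \<in> {0..pi}")
      case True
      then have "v \<in> (\<Pi>\<^sub>E j\<in>{2..N}. {0..pi})"
        using v unfolding M_def N_def space_PiM by (auto simp: PiE_def)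
      then show ?thesis using True unfolding I_def by simp
    next
      case False
      then have "v \<notin> (\<Pi>\<^sub>E j\<in>{2..N}. {0..pi})"
        unfolding N_def by (auto simp: PiE_def)
      moreover from False obtain k where "k \<in> {2..Suc n}" "v k \<notin> {0..pi}" by blast
      then have "(\<Prod>k\<in>{2..Suc n}. indicator {0..pi} (v k) :: complex) = 0"
        by (intro prod_zero finite_atLeastAtMost bexI[of _ k]) simp_all
      ultimately show ?thesis unfolding I_def by simp
    qed
    have V: "(\<Prod>k<N. \<Prod>j<k. z k - z j) = (\<Sum>\<sigma>\<in>P. of_int (sign \<sigma>) * (\<Prod>i<N. poly (monic_jacobi r (\<sigma> i)) (z i)))"
      unfolding P_def by (rule sum_permutes_monic_vandermonde[symmetric]) (simp_all add: degree_p lead_p)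
    have Lam: "complex_of_real (char_poly_at_one N (v(1 := t))) powr r =
       W * (\<Prod>k\<in>{2..Suc n}. complex_of_real (1 - cos (v k)) powr r)"
    proof -
      have "{1..N} = insert 1 {2..Suc n}" unfolding N_def by auto
      moreover have "(\<Prod>k\<in>{2..Suc n}. complex_of_real (1 - cos ((v(1 := t)) k)) powr r) =
        (\<Prod>k\<in>{2..Suc n}. complex_of_real (1 - cos (v k)) powr r)"
        by (intro prod.cong refl) auto
      ultimately show ?thesis unfolding char_poly_at_one_powr W_def by simp
    qed
    have "indicator (\<Pi>\<^sub>E j\<in>{2..N}. {0..pi}) v *\<^sub>R
      (complex_of_real (\<Prod>k\<in>{1..N}. \<Prod>j\<in>{1..<k}. (cos ((v(1 := t)) j) - cos ((v(1 := t)) k))\<^sup>2) *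
       complex_of_real (char_poly_at_one N (v(1 := t))) powr r) =
       I * ((\<Prod>k<N. \<Prod>j<k. z k - z j) * (\<Prod>k<N. \<Prod>j<k. z k - z j) * (W * (\<Prod>k\<in>{2..Suc n}. complex_of_real (1 - cos (v k)) powr r)))"
    proof -
      have scal: "indicator A v *\<^sub>R w = (indicator A v :: complex) * w" for A and w :: complex
        by (simp add: indicator_def)
      show ?thesis
        unfolding prod_cos_diff_eq_vandermonde Lam scal
        unfolding power2_eq_square I_def z_def mult.assoc ..
    qed
    also have "\<dots> = (\<Sum>\<sigma>\<in>P. \<Sum>\<tau>\<in>P. (I * (W * (\<Prod>k\<in>{2..Suc n}. complex_of_real (1 - cos (v k)) powr r))) *
        ((of_int (sign \<sigma>) * (\<Prod>i<N. poly (monic_jacobi r (\<sigma> i)) (z i))) *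
         (of_int (sign \<tau>) * (\<Prod>i<N. poly (monic_jacobi r (\<tau> i)) (z i)))))"
      unfolding V sum_product sum_distrib_left[symmetric] by (simp only: mult_ac)
    also have "\<dots> = (\<Sum>\<sigma>\<in>P. \<Sum>\<tau>\<in>P. c \<sigma> \<tau> * (\<Prod>k\<in>{2..Suc n}. \<phi> (monic_jacobi r (\<sigma> (k - 1)) * monic_jacobi r (\<tau> (k - 1))) (v k)))"
    proof (intro sum.cong refl)
      fix \<sigma> \<tau> :: "nat \<Rightarrow> nat"
      have "(\<Prod>k\<in>{2..Suc n}. \<phi> (monic_jacobi r (\<sigma> (k - 1)) * monic_jacobi r (\<tau> (k - 1))) (v k)) =
        (\<Prod>k\<in>{2..Suc n}. indicator {0..pi} (v k) * (poly (monic_jacobi r (\<sigma> (k - 1))) (z (k - 1)) *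
           poly (monic_jacobi r (\<tau> (k - 1))) (z (k - 1)) * complex_of_real (1 - cos (v k)) powr r))"
      proof (rule prod.cong[OF refl])
        fix k assume k: "k \<in> {2..Suc n}"
        show "\<phi> (monic_jacobi r (\<sigma> (k - 1)) * monic_jacobi r (\<tau> (k - 1))) (v k) =
          indicator {0..pi} (v k) * (poly (monic_jacobi r (\<sigma> (k - 1))) (z (k - 1)) *
           poly (monic_jacobi r (\<tau> (k - 1))) (z (k - 1)) * complex_of_real (1 - cos (v k)) powr r)"
          unfolding zk[OF k] \<phi>_def by (simp add: indicator_def)
      qed
      also have "\<dots> = I * ((\<Prod>k\<in>{2..Suc n}. poly (monic_jacobi r (\<sigma> (k - 1))) (z (k - 1))) *
           (\<Prod>k\<in>{2..Suc n}. poly (monic_jacobi r (\<tau> (k - 1))) (z (k - 1))) *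
           (\<Prod>k\<in>{2..Suc n}. complex_of_real (1 - cos (v k)) powr r))"
        unfolding I by (simp only: prod.distrib)
      finally show "(I * (W * (\<Prod>k\<in>{2..Suc n}. complex_of_real (1 - cos (v k)) powr r))) *
        ((of_int (sign \<sigma>) * (\<Prod>i<N. poly (monic_jacobi r (\<sigma> i)) (z i))) *
         (of_int (sign \<tau>) * (\<Prod>i<N. poly (monic_jacobi r (\<tau> i)) (z i)))) =
        c \<sigma> \<tau> * (\<Prod>k\<in>{2..Suc n}. \<phi> (monic_jacobi r (\<sigma> (k - 1)) * monic_jacobi r (\<tau> (k - 1))) (v k))"
        unfolding shift c_def z0 by (simp only: mult_ac)
    qed
    finally show ?thesis .
  qed
  have int: "integrable lborel (\<phi> q)" and val: "(LINT y|lborel. \<phi> q y) = jacobi_functional r q" for q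
    using jacobi_weight_lborel[OF r] by (simp_all add: \<phi>_def[abs_def])
  have pint: "integrable M (\<lambda>v. \<Prod>k\<in>{2..Suc n}. \<phi> (monic_jacobi r (\<sigma> (k - 1)) * monic_jacobi r (\<tau> (k - 1))) (v k))" for \<sigma> \<tau>
    unfolding M_def by (rule product_integrable_prod) (auto intro: int)
  have pval: "(LINT v|M. (\<Prod>k\<in>{2..Suc n}. \<phi> (monic_jacobi r (\<sigma> (k - 1)) * monic_jacobi r (\<tau> (k - 1))) (v k))) =
     (\<Prod>i\<in>{1..n}. jacobi_functional r (monic_jacobi r (\<sigma> i) * monic_jacobi r (\<tau> i)))" for \<sigma> \<tau>
  proof -
    have "(LINT v|M. (\<Prod>k\<in>{2..Suc n}. \<phi> (monic_jacobi r (\<sigma> (k - 1)) * monic_jacobi r (\<tau> (k - 1))) (v k))) =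
      (\<Prod>k\<in>{2..Suc n}. (LINT y|lborel. \<phi> (monic_jacobi r (\<sigma> (k - 1)) * monic_jacobi r (\<tau> (k - 1))) y))"
      unfolding M_def by (rule product_integral_prod) (auto intro: int)
    also have "\<dots> = (\<Prod>i\<in>{1..n}. jacobi_functional r (monic_jacobi r (\<sigma> i) * monic_jacobi r (\<tau> i)))"
      unfolding val by (rule prod.reindex_bij_witness[of _ Suc "\<lambda>k. k - 1"]) auto
    finally show ?thesis .
  qed
  have "(LINT v|M. indicator (\<Pi>\<^sub>E j\<in>{2..N}. {0..pi}) v *\<^sub>R
      (complex_of_real (\<Prod>k\<in>{1..N}. \<Prod>j\<in>{1..<k}. (cos ((v(1 := t)) j) - cos ((v(1 := t)) k))\<^sup>2) *
       complex_of_real (char_poly_at_one N (v(1 := t))) powr r)) =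
     (LINT v|M. (\<Sum>\<sigma>\<in>P. \<Sum>\<tau>\<in>P. c \<sigma> \<tau> * (\<Prod>k\<in>{2..Suc n}. \<phi> (monic_jacobi r (\<sigma> (k - 1)) * monic_jacobi r (\<tau> (k - 1))) (v k))))"
    by (rule Bochner_Integration.integral_cong[OF refl expand])
  also have "\<dots> = (\<Sum>\<sigma>\<in>P. \<Sum>\<tau>\<in>P. c \<sigma> \<tau> * (\<Prod>i\<in>{1..n}. jacobi_functional r (monic_jacobi r (\<sigma> i) * monic_jacobi r (\<tau> i))))"
    by (subst Bochner_Integration.integral_sum, intro Bochner_Integration.integrable_sum integrable_mult_right pint,
        intro sum.cong refl, subst Bochner_Integration.integral_sum, intro integrable_mult_right pint,
        simp only: integral_mult_right_zero pval)
  also have "\<dots> = W * (\<Sum>\<sigma>\<in>P. \<Sum>\<tau>\<in>P. of_int (sign \<sigma>) * of_int (sign \<tau>) *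
      (poly (monic_jacobi r (\<sigma> 0)) x * poly (monic_jacobi r (\<tau> 0)) x) *
      (\<Prod>i\<in>{1..n}. jacobi_functional r (monic_jacobi r (\<sigma> i) * monic_jacobi r (\<tau> i))))"
    unfolding c_def by (simp only: sum_distrib_left mult.assoc)
  also have "\<dots> = W * (fact n * (\<Prod>j<N. jacobi_norm r j) * (\<Sum>j\<le>n. poly (monic_jacobi r j) x ^ 2 / jacobi_norm r j))"
    unfolding P_def N_def sum_permutes_orthogonal ..
  finally show ?thesis unfolding W_def x_def by (simp only: mult_ac)
qed

section \<open>The Perron kernel\<close>

text \<open>The truncated Perron integral of \<open>exp (r * y) / r\<close>, parametrized by the
  imaginary part of \<open>r\<close>; the factor \<open>\<i>\<close> from
  \<open>dr = \<i> dt\<close> is left out.\<close>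

definition perron_kernel :: "real \<Rightarrow> real \<Rightarrow> real \<Rightarrow> complex" where
  "perron_kernel c T y = integral {-T..T} (\<lambda>t. exp (Complex c t * of_real y) / Complex c t)"

lemma Complex_nonzero: "c > 0 \<Longrightarrow> Complex c t \<noteq> 0"
  by (auto simp: complex_eq_iff)

lemma has_integral_exp_Complex:
  assumes "T > 0"
  shows "((\<lambda>t. exp (Complex c t * of_real y)) has_integral
           of_real (exp (c * y) * (2 * T * sinc (T * y)))) {-T..T}"
proof (cases "y = 0")
  case True
  then show ?thesis using assms has_integral_const_real[of "1::complex" "-T" T]
    by (simp add: scaleR_conv_of_real)
next
  case False
  define E where "E t = exp (complex_of_real (c * y)) * exp (\<i> * of_real (t * y)) / (\<i> * of_real y)" for t :: real
  have "((\<lambda>t. exp (Complex c t * of_real y)) has_integral (E T - E (-T))) {-T..T}"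
  proof (rule fundamental_theorem_of_calculus)
    fix t assume "t \<in> {-T..T}"
    have "((\<lambda>z. exp (complex_of_real (c * y)) * exp (\<i> * (z * of_real y)) / (\<i> * of_real y)) has_field_derivative
        exp (complex_of_real (c * y)) * exp (\<i> * (of_real t * of_real y))) (at (of_real t))"
      using False by (auto intro!: derivative_eq_intros simp: algebra_simps)
    from has_vector_derivative_real_field[OF this]
    have "(E has_vector_derivative exp (complex_of_real (c * y)) * exp (\<i> * (of_real t * of_real y))) (at t within {-T..T})"
      by (simp add: E_def[abs_def] o_def)
    also have "exp (complex_of_real (c * y)) * exp (\<i> * (of_real t * of_real y)) = exp (Complex c t * of_real y)"
      by (simp add: Complex_eq algebra_simps flip: exp_add)
    finally show "(E has_vector_derivative exp (Complex c t * of_real y)) (at t within {-T..T})" .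
  qed (use assms in simp)
  moreover have "E T - E (-T) = of_real (exp (c * y) * (2 * T * sinc (T * y)))"
  proof -
    have e: "exp (\<i> * of_real (T * y)) - exp (\<i> * of_real (- T * y)) = 2 * \<i> * of_real (sin (T * y))"
    proof -
      have a: "exp (\<i> * complex_of_real x) = of_real (cos x) + \<i> * of_real (sin x)" for x
        by (simp only: exp_Euler cos_of_real sin_of_real)
      show ?thesis
        unfolding a mult_minus_left cos_minus sin_minus by simp
    qed
    have "E T - E (-T) = exp (complex_of_real (c * y)) *
        (exp (\<i> * of_real (T * y)) - exp (\<i> * of_real (- T * y))) / (\<i> * of_real y)"
      unfolding E_def by (simp only: diff_divide_distrib right_diff_distrib)
    also have "\<dots> = exp (complex_of_real (c * y)) * (2 * \<i> * of_real (sin (T * y))) / (\<i> * of_real y)"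
      by (simp only: e)
    also have "\<dots> = of_real (exp (c * y) * (2 * T * (sin (T * y) / (T * y))))"
    proof -
      have "complex_of_real a * (2 * \<i> * of_real s) / (\<i> * of_real y) = of_real (a * (2 * T * (s / (T * y))))" for a s
        using False assms by (simp add: field_simps)
      then show ?thesis unfolding exp_of_real .
    qed
    finally show ?thesis using False assms by simp
  qed
  ultimately show ?thesis by simp
qed

text \<open>Differentiating in \<open>y\<close> cancels the denominator and leaves an elementary
  real integral, so the kernel is determined by this derivative and its value at
  \<open>y = 0\<close>.\<close>

lemma perron_kernel_has_vector_derivative:
  assumes "c > 0" "T > 0"
  shows "((\<lambda>y. perron_kernel c T y) has_vector_derivative
    of_real (exp (c * y) * (2 * T * sinc (T * y)))) (at y)"
proof -
  have "((\<lambda>y. integral (cbox (-T) T) (\<lambda>t. exp (Complex c t * of_real y) / Complex c t)) has_vector_derivative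
     integral (cbox (-T) T) (\<lambda>t. exp (Complex c t * of_real y))) (at y within UNIV)"
  proof (rule leibniz_rule_vector_derivative)
    fix x t
    have "((\<lambda>z. exp (Complex c t * z) / Complex c t) has_field_derivative exp (Complex c t * of_real x)) (at (of_real x))"
      using Complex_nonzero[OF assms(1)] by (auto intro!: derivative_eq_intros)
    from has_vector_derivative_real_field[OF this]
    show "((\<lambda>x. exp (Complex c t * of_real x) / Complex c t) has_vector_derivative exp (Complex c t * of_real x)) (at x within UNIV)"
      by (simp add: o_def)
  next
    fix x
    show "(\<lambda>t. exp (Complex c t * of_real x) / Complex c t) integrable_on cbox (-T) T"
      unfolding Complex_eq using Complex_nonzero[OF assms(1), unfolded Complex_eq]
      by (intro integrable_continuous continuous_intros) auto
  next
    show "continuous_on (UNIV \<times> cbox (-T) T) (\<lambda>(y, t). exp (Complex c t * of_real y))"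
      unfolding Complex_eq split_def by (intro continuous_intros)
  qed auto
  then show ?thesis
    using integral_unique[OF has_integral_exp_Complex[OF assms(2), of c y]]
    by (simp add: perron_kernel_def)
qed

text \<open>The real part of \<open>1 / (c + \<i> t)\<close> integrates to an arctangent; the
  imaginary part is odd in \<open>t\<close> and cancels.\<close>

lemma perron_kernel_0:
  assumes "c > 0" "T > 0"
  shows "perron_kernel c T 0 = of_real (2 * arctan (T / c))"
proof -
  define E where "E t = complex_of_real (arctan (t / c)) - \<i> * of_real (ln (c\<^sup>2 + t\<^sup>2) / 2)" for t
  have "((\<lambda>t. exp (Complex c t * of_real 0) / Complex c t) has_integral (E T - E (-T))) {-T..T}"
  proof (rule fundamental_theorem_of_calculus)
    fix t assume "t \<in> {-T..T}"
    have p: "c\<^sup>2 + t\<^sup>2 > 0" using assms by (simp add: sum_power2_gt_zero_iff)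
    have 1: "((\<lambda>t. arctan (t / c)) has_real_derivative c / (c\<^sup>2 + t\<^sup>2)) (at t within {-T..T})"
      using assms p by (auto intro!: derivative_eq_intros simp: field_simps power2_eq_square)
    have 2: "((\<lambda>t. ln (c\<^sup>2 + t\<^sup>2) / 2) has_real_derivative t / (c\<^sup>2 + t\<^sup>2)) (at t within {-T..T})"
      using assms p by (auto intro!: derivative_eq_intros simp: field_simps power2_eq_square)
    have "(E has_vector_derivative of_real (c / (c\<^sup>2 + t\<^sup>2)) - \<i> * of_real (t / (c\<^sup>2 + t\<^sup>2))) (at t within {-T..T})"
      unfolding E_def
      using 1 2 by (intro has_vector_derivative_diff has_vector_derivative_mult_right has_vector_derivative_of_real)
        (auto simp: has_real_derivative_iff_has_vector_derivative)
    also have "of_real (c / (c\<^sup>2 + t\<^sup>2)) - \<i> * of_real (t / (c\<^sup>2 + t\<^sup>2)) = exp (Complex c t * of_real 0) / Complex c t"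
      using p by (simp add: complex_eq_iff Re_divide Im_divide power2_eq_square[of "c\<^sup>2 + t\<^sup>2"])
    finally show "(E has_vector_derivative exp (Complex c t * of_real 0) / Complex c t) (at t within {-T..T})" .
  qed (use assms in simp)
  then show ?thesis
    unfolding perron_kernel_def by (simp add: integral_unique E_def arctan_minus)
qed

lemma Im_perron_kernel:
  assumes "c > 0" "T > 0"
  shows "Im (perron_kernel c T y) = 0"
proof -
  have "((\<lambda>y. Im (perron_kernel c T y)) has_real_derivative 0) (at y)" for y
    using bounded_linear.has_vector_derivative[OF bounded_linear_Im
        perron_kernel_has_vector_derivative[OF assms, of y]]
    by (simp add: has_real_derivative_iff_has_vector_derivative)
  then show ?thesis
    using DERIV_isconst_all[of "\<lambda>y. Im (perron_kernel c T y)" y 0] perron_kernel_0[OF assms] by simp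
qed

text \<open>The sine integral is bounded and converges, which gives both the bound uniform in \<open>T\<close> and the limit below.\<close>
lemma perron_kernel_by_parts:
  assumes "c > 0" "T > 0" "a \<le> b"
  shows "((\<lambda>u. - 2 * c * exp (c * u) * Si (T * u)) has_integral
    Re (perron_kernel c T b) - 2 * exp (c * b) * Si (T * b) - (Re (perron_kernel c T a) - 2 * exp (c * a) * Si (T * a))) {a..b}"
proof -
  have Re': "((\<lambda>y. Re (perron_kernel c T y)) has_real_derivative exp (c * y) * (2 * T * sinc (T * y))) (at y)" for y
    using bounded_linear.has_vector_derivative[OF bounded_linear_Re perron_kernel_has_vector_derivative[OF assms(1,2), of y]]
    by (simp add: has_real_derivative_iff_has_vector_derivative)
  show "((\<lambda>u. - 2 * c * exp (c * u) * Si (T * u)) has_integral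
    Re (perron_kernel c T b) - 2 * exp (c * b) * Si (T * b) - (Re (perron_kernel c T a) - 2 * exp (c * a) * Si (T * a))) {a..b}"
  proof (rule fundamental_theorem_of_calculus[OF assms(3)])
    fix u assume "u \<in> {a..b}"
    have "((\<lambda>u. T * u) has_real_derivative T) (at u)" by (auto intro!: derivative_eq_intros)
    from DERIV_chain2[OF DERIV_Si this]
    have Si': "((\<lambda>u. Si (T * u)) has_real_derivative sinc (T * u) * T) (at u)" .
    have e': "((\<lambda>u. 2 * exp (c * u)) has_real_derivative 2 * c * exp (c * u)) (at u)"
      by (auto intro!: derivative_eq_intros)
    \<comment> \<open>The subtracted term is chosen so that the factor
      \<open>T * sinc (T * u)\<close>, which is not bounded uniformly in \<open>T\<close>, cancels.
      Only \<open>Si\<close> itself remains.\<close>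
    have "((\<lambda>u. Re (perron_kernel c T u) - 2 * exp (c * u) * Si (T * u)) has_real_derivative
       exp (c * u) * (2 * T * sinc (T * u)) - (2 * c * exp (c * u) * Si (T * u) + sinc (T * u) * T * (2 * exp (c * u)))) (at u)"
      by (rule DERIV_diff[OF Re' DERIV_mult[OF e' Si']])
    also have "exp (c * u) * (2 * T * sinc (T * u)) - (2 * c * exp (c * u) * Si (T * u) + sinc (T * u) * T * (2 * exp (c * u)))
      = - 2 * c * exp (c * u) * Si (T * u)" by (simp only: algebra_simps)
    finally show "((\<lambda>u. Re (perron_kernel c T u) - 2 * exp (c * u) * Si (T * u)) has_vector_derivative
       - 2 * c * exp (c * u) * Si (T * u)) (at u within {a..b})"
      by (simp add: has_real_derivative_iff_has_vector_derivative has_vector_derivative_at_within)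
  qed
qed

lemma has_integral_exp_scaled:
  assumes "a \<le> b"
  shows "((\<lambda>u. k * (c * exp (c * u))) has_integral k * (exp (c * b) - exp (c * a))) {a..b :: real}"
  by (rule has_integral_mult_right, rule fundamental_theorem_of_calculus[OF assms])
    (auto intro!: derivative_eq_intros simp flip: has_real_derivative_iff_has_vector_derivative)

text \<open>The kernel is compared with its value at 0, which is at most \<open>pi\<close> in
  modulus. The boundary term and the remaining integral are each at most \<open>2 * S\<close> times
  an exponential, bounded as long as \<open>y\<close> is bounded above.\<close>

lemma perron_kernel_bounded:
  assumes "c > 0"
  obtains B where "\<And>T y. T > 0 \<Longrightarrow> y \<le> Y \<Longrightarrow> cmod (perron_kernel c T y) \<le> B"
proof -
  obtain S where S: "\<And>t. \<bar>Si t\<bar> \<le> S" using bounded_Si by blast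
  have S0: "S \<ge> 0" using S[of 0] by linarith
  have diff: "\<bar>Re (perron_kernel c T b) - 2 * exp (c * b) * Si (T * b) - (Re (perron_kernel c T a) - 2 * exp (c * a) * Si (T * a))\<bar>
      \<le> 2 * S * exp (c * b)" if "T > 0" "a \<le> b" for T a b
  proof -
    note I = perron_kernel_by_parts[OF assms that]
    have "norm (integral {a..b} (\<lambda>u. - 2 * c * exp (c * u) * Si (T * u))) \<le>
      integral {a..b} (\<lambda>u. 2 * S * (c * exp (c * u)))"
    proof (rule integral_norm_bound_integral)
      show "(\<lambda>u. - 2 * c * exp (c * u) * Si (T * u)) integrable_on {a..b}" using I by blast
      show "(\<lambda>u. 2 * S * (c * exp (c * u))) integrable_on {a..b}" using has_integral_exp_scaled[OF that(2)] by blast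
      fix u
      have "c * exp (c * u) * \<bar>Si (T * u)\<bar> \<le> c * exp (c * u) * S"
        using S assms by (intro mult_left_mono) auto
      then show "norm (- 2 * c * exp (c * u) * Si (T * u)) \<le> 2 * S * (c * exp (c * u))"
        using assms by (simp add: abs_mult mult_ac)
    qed
    also have "\<dots> = 2 * S * (exp (c * b) - exp (c * a))"
      by (rule integral_unique[OF has_integral_exp_scaled[OF that(2)]])
    also have "\<dots> \<le> 2 * S * exp (c * b)" using S0 by (intro mult_left_mono) auto
    finally show ?thesis unfolding integral_unique[OF I] by simp
  qed
  \<comment> \<open>One exponential must dominate at both ends of the interval between 0 and
    \<open>y\<close>, whichever of them is the larger.\<close>
  define Z where "Z = max Y 0"
  have "cmod (perron_kernel c T y) \<le> pi + 4 * S * exp (c * Z)" if "T > 0" "y \<le> Y" for T y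
  proof -
    have yZ: "exp (c * y) \<le> exp (c * Z)" "exp (c * 0) \<le> exp (c * Z)" using that assms unfolding Z_def
      by (auto intro!: mult_left_mono)
    have "\<bar>Re (perron_kernel c T y) - 2 * exp (c * y) * Si (T * y) - (Re (perron_kernel c T 0) - 2 * exp (c * 0) * Si (T * 0))\<bar>
      \<le> 2 * S * exp (c * Z)"
    proof (cases "y \<le> 0")
      case True
      have "2 * S * exp (c * 0) \<le> 2 * S * exp (c * Z)" using yZ S0 by (intro mult_left_mono) auto
      with diff[OF that(1) True] show ?thesis by linarith
    next
      case False
      have "2 * S * exp (c * y) \<le> 2 * S * exp (c * Z)" using yZ S0 by (intro mult_left_mono) auto
      with diff[OF that(1), of 0 y] False show ?thesis by linarith
    qed
    moreover have "Si 0 = 0" using Si_neg[of 0] by simp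
    moreover have "\<bar>2 * exp (c * y) * Si (T * y)\<bar> \<le> 2 * S * exp (c * Z)"
    proof -
      have "exp (c * y) * \<bar>Si (T * y)\<bar> \<le> exp (c * Z) * S"
        using S yZ S0 by (intro mult_mono) auto
      then show ?thesis by (simp add: abs_mult mult_ac)
    qed
    moreover have "\<bar>Re (perron_kernel c T 0)\<bar> \<le> pi"
      using arctan_bounded[of "T / c"] that assms by (simp add: perron_kernel_0 abs_if)
    ultimately have "\<bar>Re (perron_kernel c T y)\<bar> \<le> pi + 4 * S * exp (c * Z)" by (simp split: abs_split)
    then show ?thesis using Im_perron_kernel[OF assms that(1), of y] by (simp add: cmod_eq_Re)
  qed
  then show thesis by (rule that)
qed

lemma Si_scaled_tendsto: "((\<lambda>T. Si (T * u)) \<longlongrightarrow> sgn u * (pi / 2)) at_top"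
proof -
  have pos: "((\<lambda>T. Si (T * u)) \<longlongrightarrow> pi / 2) at_top" if "u > 0" for u
    using filterlim_compose[OF Si_at_top filterlim_tendsto_pos_mult_at_top[OF tendsto_const that filterlim_ident]]
    by (simp add: mult.commute)
  consider "u > 0" | "u = 0" | "u < 0" by linarith
  then show ?thesis
  proof cases
    case 3
    have "((\<lambda>T. - Si (T * (- u))) \<longlongrightarrow> - (pi / 2)) at_top"
      using 3 by (intro tendsto_minus pos) simp
    moreover have "\<forall>\<^sub>F T in at_top. - Si (T * (- u)) = Si (T * u)"
      using eventually_ge_at_top[of "0::real"]
    proof eventually_elim
      case (elim T)
      then show ?case using Si_neg[of "T * (- u)"] 3 by (simp add: mult_nonneg_nonpos)
    qed
    ultimately show ?thesis using 3 by (simp add: tendsto_cong)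
  next
    case 2
    then show ?thesis using Si_neg[of 0] by simp
  qed (use pos in simp)
qed

text \<open>In the formula by parts between 0 and \<open>y\<close>, \<open>Si (T * u)\<close> tends
  to \<open>sgn u * pi / 2\<close>. The terms with \<open>exp (c * y)\<close> cancel and
  \<open>pi + sgn y * pi\<close> is left, which at \<open>y = 0\<close> is the mean value.\<close>

lemma perron_kernel_tendsto:
  assumes "c > 0"
  shows "((\<lambda>T. perron_kernel c T y) \<longlongrightarrow> of_real (2 * pi * heaviside y)) at_top"
proof -
  obtain S where S: "\<And>t. \<bar>Si t\<bar> \<le> S" using bounded_Si by blast
  have lim: "((\<lambda>T. integral {a..b} (\<lambda>u. - 2 * c * exp (c * u) * Si (T * u))) \<longlongrightarrow> - (k * pi * (exp (c * b) - exp (c * a)))) at_top"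
    if "a \<le> b" and k: "\<And>u. u \<in> {a<..<b} \<Longrightarrow> sgn u = k" for a b k
  proof -
    have cSi: "continuous_on A (\<lambda>u. Si (T * u))" for T A
      by (rule continuous_on_compose2[of UNIV Si]) (auto intro!: continuous_intros continuous_at_imp_continuous_on isCont_Si)
    have int: "set_integrable lborel {a..b} (\<lambda>u. - 2 * c * exp (c * u) * Si (T * u))" for T
      by (intro borel_integrable_atLeastAtMost' continuous_intros cSi)
    have int2: "set_integrable lborel {a..b} (\<lambda>u. - k * pi * (c * exp (c * u)))"
      by (intro borel_integrable_atLeastAtMost' continuous_intros)
    have "((\<lambda>T. LINT u:{a..b}|lborel. - 2 * c * exp (c * u) * Si (T * u)) \<longlongrightarrow>
       (LINT u:{a..b}|lborel. - k * pi * (c * exp (c * u)))) at_top"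
      unfolding set_lebesgue_integral_def
    proof (rule integral_dominated_convergence_at_top)
      show "(\<lambda>u. indicator {a..b} u *\<^sub>R (- k * pi * (c * exp (c * u)))) \<in> borel_measurable lborel"
        using int2 by (simp add: set_integrable_def)
      show "(\<lambda>u. indicator {a..b} u *\<^sub>R (- 2 * c * exp (c * u) * Si (T * u))) \<in> borel_measurable lborel" for T
        using int[of T] by (simp add: set_integrable_def)
      have "set_integrable lborel {a..b} (\<lambda>u. 2 * S * (c * exp (c * u)))"
        by (intro borel_integrable_atLeastAtMost' continuous_intros)
      then show "integrable lborel (\<lambda>u. indicator {a..b} u *\<^sub>R (2 * S * (c * exp (c * u))))"
        by (simp add: set_integrable_def)
      show "\<forall>\<^sub>F T in at_top. AE u in lborel. norm (indicator {a..b} u *\<^sub>R (- 2 * c * exp (c * u) * Si (T * u)))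
          \<le> indicator {a..b} u *\<^sub>R (2 * S * (c * exp (c * u)))"
      proof (intro always_eventually allI AE_I2)
        fix T u
        have "c * exp (c * u) * \<bar>Si (T * u)\<bar> \<le> c * exp (c * u) * S"
          using S assms by (intro mult_left_mono) auto
        then show "norm (indicator {a..b} u *\<^sub>R (- 2 * c * exp (c * u) * Si (T * u)))
          \<le> indicator {a..b} u *\<^sub>R (2 * S * (c * exp (c * u)))"
          using assms by (auto simp: indicator_def abs_mult mult_ac)
      qed
      \<comment> \<open>The sign is known to be \<open>k\<close> only inside the interval; the end
        points, one of which is 0 in both uses, form a null set.\<close>
      show "AE u in lborel. ((\<lambda>T. indicator {a..b} u *\<^sub>R (- 2 * c * exp (c * u) * Si (T * u))) \<longlongrightarrow>
         indicator {a..b} u *\<^sub>R (- k * pi * (c * exp (c * u)))) at_top"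
        using AE_lborel_singleton[of a] AE_lborel_singleton[of b]
      proof eventually_elim
        case (elim u)
        show ?case
        proof (cases "u \<in> {a..b}")
          case True
          then have "sgn u = k" using k elim by auto
          have "((\<lambda>T. - 2 * c * exp (c * u) * Si (T * u)) \<longlongrightarrow> - 2 * c * exp (c * u) * (sgn u * (pi / 2))) at_top"
            by (intro tendsto_mult tendsto_const Si_scaled_tendsto)
          then show ?thesis using True \<open>sgn u = k\<close> by (simp add: mult_ac)
        qed simp
      qed
    qed
    also have "(LINT u:{a..b}|lborel. - k * pi * (c * exp (c * u))) = - k * pi * (exp (c * b) - exp (c * a))"
      unfolding set_borel_integral_eq_integral(2)[OF int2]
      by (rule integral_unique[OF has_integral_exp_scaled[OF that(1)]])
    finally show ?thesis
      unfolding set_borel_integral_eq_integral(2)[OF int] by simp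
  qed
  have "((\<lambda>T. arctan (T / c)) \<longlongrightarrow> pi / 2) at_top"
    using filterlim_compose[OF tendsto_arctan_at_top
        filterlim_tendsto_pos_mult_at_top[OF tendsto_const _ filterlim_ident, of "1 / c"]] assms by simp
  then have at0: "((\<lambda>T. 2 * arctan (T / c)) \<longlongrightarrow> pi) at_top"
    using tendsto_mult_left[of "\<lambda>T. arctan (T / c)" "pi / 2" at_top 2] by simp
  have Si0: "Si 0 = 0" using Si_neg[of 0] by simp
  have "((\<lambda>T. Re (perron_kernel c T y)) \<longlongrightarrow> 2 * pi * heaviside y) at_top"
  proof (cases "y \<ge> 0")
    case True
    have "((\<lambda>T. integral {0..y} (\<lambda>u. - 2 * c * exp (c * u) * Si (T * u)) + 2 * exp (c * y) * Si (T * y) + 2 * arctan (T / c)) \<longlongrightarrow>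
       - (1 * pi * (exp (c * y) - exp (c * 0))) + 2 * exp (c * y) * (sgn y * (pi / 2)) + pi) at_top"
      using True by (intro tendsto_add tendsto_mult tendsto_const Si_scaled_tendsto lim at0) auto
    moreover have "\<forall>\<^sub>F T in at_top. integral {0..y} (\<lambda>u. - 2 * c * exp (c * u) * Si (T * u)) + 2 * exp (c * y) * Si (T * y) + 2 * arctan (T / c)
        = Re (perron_kernel c T y)"
      using eventually_gt_at_top[of 0]
    proof eventually_elim
      case (elim T)
      show ?case
        using integral_unique[OF perron_kernel_by_parts[OF assms elim True]] perron_kernel_0[OF assms elim] Si0
        by simp
    qed
    moreover have "- (1 * pi * (exp (c * y) - exp (c * 0))) + 2 * exp (c * y) * (sgn y * (pi / 2)) + pi = 2 * pi * heaviside y"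
      using True by (cases "y = 0") (auto simp: heaviside_def algebra_simps)
    ultimately show ?thesis by (simp only: tendsto_cong)
  next
    case False
    then have y: "y \<le> 0" by simp
    have "((\<lambda>T. 2 * arctan (T / c) + 2 * exp (c * y) * Si (T * y) - integral {y..0} (\<lambda>u. - 2 * c * exp (c * u) * Si (T * u))) \<longlongrightarrow>
       pi + 2 * exp (c * y) * (sgn y * (pi / 2)) - (- ((-1) * pi * (exp (c * 0) - exp (c * y))))) at_top"
      using False by (intro tendsto_diff tendsto_add tendsto_mult tendsto_const Si_scaled_tendsto lim at0) auto
    moreover have "\<forall>\<^sub>F T in at_top. 2 * arctan (T / c) + 2 * exp (c * y) * Si (T * y) - integral {y..0} (\<lambda>u. - 2 * c * exp (c * u) * Si (T * u))
        = Re (perron_kernel c T y)"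
      using eventually_gt_at_top[of 0]
    proof eventually_elim
      case (elim T)
      show ?case
        using integral_unique[OF perron_kernel_by_parts[OF assms elim y]] perron_kernel_0[OF assms elim] Si0
        by simp
    qed
    moreover have "pi + 2 * exp (c * y) * (sgn y * (pi / 2)) - (- ((-1) * pi * (exp (c * 0) - exp (c * y)))) = 2 * pi * heaviside y"
      using False by (auto simp: heaviside_def algebra_simps)
    ultimately show ?thesis by (simp only: tendsto_cong)
  qed
  then have "((\<lambda>T. complex_of_real (Re (perron_kernel c T y))) \<longlongrightarrow> of_real (2 * pi * heaviside y)) at_top"
    by (rule tendsto_of_real)
  moreover have "\<forall>\<^sub>F T in at_top. complex_of_real (Re (perron_kernel c T y)) = perron_kernel c T y"
    using eventually_gt_at_top[of 0]
  proof eventually_elim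
    case (elim T)
    then show ?case using Im_perron_kernel[OF assms elim, of y] by (simp add: complex_eq_iff)
  qed
  ultimately show ?thesis by (simp only: tendsto_cong)
qed

section \<open>Mellin inversion under the integral sign\<close>

text \<open>On the line, \<open>exp (r * L v)\<close> has modulus \<open>exp (c * L v)\<close>, so
  an upper bound on \<open>L\<close> suffices for Fubini on each segment and for domination as
  \<open>T\<close> grows. The bound is asked only where \<open>g\<close> is non-zero, so a
  conventional value of \<open>L\<close> elsewhere does no harm.\<close>

lemma has_vertical_integral_Mellin_transform:
  fixes M :: "'a measure" and g L :: "'a \<Rightarrow> real"
  assumes "sigma_finite_measure M" and g: "integrable M g" and L[measurable]: "L \<in> borel_measurable M"
    and LB: "\<And>v. v \<in> space M \<Longrightarrow> g v \<noteq> 0 \<Longrightarrow> L v \<le> B" and c: "c > 0"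
    and f: "\<And>r. Re r = c \<Longrightarrow>
      f r = exp (- r * of_real X) / r * (LINT v|M. of_real (g v) * exp (r * of_real (L v)))"
  shows "has_vertical_integral f c (2 * of_real pi * \<i> * of_real (LINT v|M. g v * heaviside (L v - X)))"
proof -
  interpret M: sigma_finite_measure M by fact
  interpret P: pair_sigma_finite M lborel ..
  have [measurable]: "g \<in> borel_measurable M" using g by auto
  define F where "F T v t = indicator {-T..T} t *\<^sub>R
    (of_real (g v) * (exp (Complex c t * of_real (L v - X)) / Complex c t))" for T v t
  have Fm: "(\<lambda>(v, t). F T v t) \<in> borel_measurable (M \<Otimes>\<^sub>M lborel)" for T
    unfolding F_def Complex_eq by measurable
  have kint: "set_integrable lborel {-T..T} (\<lambda>t. exp (Complex c t * of_real y) / Complex c t)" for T y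
    unfolding Complex_eq using Complex_nonzero[OF c, unfolded Complex_eq]
    by (intro borel_integrable_atLeastAtMost' continuous_intros) auto
  have F2: "integrable lborel (F T v)" for T v
  proof -
    have "integrable lborel (\<lambda>t. of_real (g v) * (indicator {-T..T} t *\<^sub>R (exp (Complex c t * of_real (L v - X)) / Complex c t)))"
      using kint[of T "L v - X"] by (intro integrable_mult_right) (simp add: set_integrable_def)
    then show ?thesis by (simp add: F_def[abs_def])
  qed
  have F_eq: "(LINT t|lborel. F T v t) = of_real (g v) * perron_kernel c T (L v - X)" for T v
  proof -
    have "(LINT t|lborel. F T v t) = of_real (g v) * (LINT t:{-T..T}|lborel. exp (Complex c t * of_real (L v - X)) / Complex c t)"
      unfolding F_def set_lebesgue_integral_def by (simp flip: integral_mult_right_zero)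
    then show ?thesis
      unfolding perron_kernel_def set_borel_integral_eq_integral(2)[OF kint] .
  qed
  have Fint: "integrable (M \<Otimes>\<^sub>M lborel) (\<lambda>(v, t). F T v t)" for T
  proof (rule P.Fubini_integrable[OF Fm])
    \<comment> \<open>The modulus of \<open>F\<close> separates into a function of \<open>v\<close>
      and a function of \<open>t\<close>; \<open>k\<close> is the integral of the latter, finite
      because the segment is bounded and avoids 0.\<close>
    define k where "k = (LINT t|lborel. indicator {-T..T} t / cmod (Complex c t))"
    have nF: "(LINT t|lborel. norm (F T v t)) = \<bar>g v\<bar> * exp (c * (L v - X)) * k" for v
    proof -
      have "norm (F T v t) = \<bar>g v\<bar> * exp (c * (L v - X)) * (indicator {-T..T} t / cmod (Complex c t))" for t
        by (simp add: F_def norm_mult norm_divide indicator_def)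
      then show ?thesis by (simp only: k_def integral_mult_right_zero)
    qed
    have "integrable M (\<lambda>v. \<bar>g v\<bar> * exp (c * (L v - X)) * k)"
    proof (rule Bochner_Integration.integrable_bound)
      show "integrable M (\<lambda>v. \<bar>g v\<bar> * (exp (c * (B - X)) * \<bar>k\<bar>))"
        using g by simp
      show "AE v in M. norm (\<bar>g v\<bar> * exp (c * (L v - X)) * k) \<le> norm (\<bar>g v\<bar> * (exp (c * (B - X)) * \<bar>k\<bar>))"
      proof (rule AE_I2)
        fix v assume v: "v \<in> space M"
        show "norm (\<bar>g v\<bar> * exp (c * (L v - X)) * k) \<le> norm (\<bar>g v\<bar> * (exp (c * (B - X)) * \<bar>k\<bar>))"
        proof (cases "g v = 0")
          case False
          then have "exp (c * (L v - X)) \<le> exp (c * (B - X))" using LB[OF v] c by simp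
          then have "\<bar>g v\<bar> * exp (c * (L v - X)) * \<bar>k\<bar> \<le> \<bar>g v\<bar> * exp (c * (B - X)) * \<bar>k\<bar>"
            by (intro mult_right_mono mult_left_mono) auto
          then show ?thesis by (simp add: abs_mult mult_ac)
        qed simp
      qed
    qed measurable
    then show "integrable M (\<lambda>v. LINT t|lborel. norm (case (v, t) of (v, t) \<Rightarrow> F T v t))"
      by (simp add: nF)
    show "AE v in M. integrable lborel (\<lambda>t. case (v, t) of (v, t) \<Rightarrow> F T v t)"
      by (simp add: F2)
  qed
  have f_eq: "(LINT v|M. F T v t) = indicator {-T..T} t *\<^sub>R f (Complex c t)" for T t
  proof -
    have "(LINT v|M. F T v t) = (LINT v|M. (indicator {-T..T} t *\<^sub>R (exp (- Complex c t * of_real X) / Complex c t)) *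
        (of_real (g v) * exp (Complex c t * of_real (L v))))"
      by (intro Bochner_Integration.integral_cong refl) (simp add: F_def algebra_simps exp_diff exp_minus divide_inverse)
    also have "\<dots> = (indicator {-T..T} t *\<^sub>R (exp (- Complex c t * of_real X) / Complex c t)) *
        (LINT v|M. (of_real (g v) * exp (Complex c t * of_real (L v))))"
      by (rule integral_mult_right_zero)
    also have "\<dots> = indicator {-T..T} t *\<^sub>R f (Complex c t)"
      by (simp add: f)
    finally show ?thesis .
  qed
  have J: "set_integrable lborel {-T..T} (\<lambda>t. f (Complex c t))"
    "(LINT t:{-T..T}|lborel. f (Complex c t)) = (LINT v|M. of_real (g v) * perron_kernel c T (L v - X))"
    "(\<lambda>v. of_real (g v) * perron_kernel c T (L v - X)) \<in> borel_measurable M" for T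
  proof -
    show "set_integrable lborel {-T..T} (\<lambda>t. f (Complex c t))"
      using P.integrable_snd[OF Fint[of T]] by (simp add: f_eq set_integrable_def)
    show "(LINT t:{-T..T}|lborel. f (Complex c t)) = (LINT v|M. of_real (g v) * perron_kernel c T (L v - X))"
      using P.Fubini_integral[OF Fint[of T]] by (simp add: f_eq F_eq set_lebesgue_integral_def)
    show "(\<lambda>v. of_real (g v) * perron_kernel c T (L v - X)) \<in> borel_measurable M"
      using P.integrable_fst[OF Fint[of T]] by (simp add: F_eq borel_measurable_integrable)
  qed
  \<comment> \<open>The factor \<open>\<i>\<close> omitted from \<open>perron_kernel\<close> returns
    here.\<close>
  have contour: "(f has_contour_integral (\<i> * (LINT v|M. of_real (g v) * perron_kernel c T (L v - X))))
      (linepath (Complex c (-T)) (Complex c T))" if "T > 0" for T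
  proof -
    have "((\<lambda>t. f (Complex c t)) has_integral (LINT v|M. of_real (g v) * perron_kernel c T (L v - X))) {-T..T}"
      using set_borel_integral_eq_integral[OF J(1)[of T]] J(2)[of T] by (simp add: has_integral_iff)
    then show ?thesis
      by (subst has_contour_integral_linepath_same_Re_iff[where a = "-T" and b = T]) (use that in auto)
  qed
  obtain K where K: "\<And>T y. T > 0 \<Longrightarrow> y \<le> B - X \<Longrightarrow> cmod (perron_kernel c T y) \<le> K"
    using perron_kernel_bounded[OF c, of "B - X"] by blast
  have hm[measurable]: "heaviside \<in> borel_measurable borel"
    unfolding heaviside_def[abs_def] by measurable
  have "((\<lambda>T. LINT v|M. of_real (g v) * perron_kernel c T (L v - X)) \<longlongrightarrow>
      (LINT v|M. of_real (g v) * of_real (2 * pi * heaviside (L v - X)))) at_top"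
  proof (rule integral_dominated_convergence_at_top)
    show "(\<lambda>v. complex_of_real (g v) * of_real (2 * pi * heaviside (L v - X))) \<in> borel_measurable M"
      by measurable
    show "integrable M (\<lambda>v. \<bar>g v\<bar> * K)" using g by simp
    show "\<forall>\<^sub>F T in at_top. AE v in M. cmod (of_real (g v) * perron_kernel c T (L v - X)) \<le> \<bar>g v\<bar> * K"
      using eventually_gt_at_top[of 0]
    proof eventually_elim
      case (elim T)
      show ?case
      proof (rule AE_I2)
        fix v assume v: "v \<in> space M"
        show "cmod (of_real (g v) * perron_kernel c T (L v - X)) \<le> \<bar>g v\<bar> * K"
        proof (cases "g v = 0")
          case False
          then show ?thesis using LB[OF v] elim
            by (auto simp: norm_mult intro!: mult_left_mono K)
        qed simp
      qed
    qed
    show "AE v in M. ((\<lambda>T. of_real (g v) * perron_kernel c T (L v - X)) \<longlongrightarrow>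
      of_real (g v) * of_real (2 * pi * heaviside (L v - X))) at_top"
      by (intro AE_I2 tendsto_mult tendsto_const perron_kernel_tendsto c)
  qed (rule J(3))
  also have "(LINT v|M. complex_of_real (g v) * of_real (2 * pi * heaviside (L v - X))) =
      complex_of_real (LINT v|M. (2 * pi) * (g v * heaviside (L v - X)))"
  proof -
    have "(LINT v|M. complex_of_real (g v) * of_real (2 * pi * heaviside (L v - X))) =
        (LINT v|M. complex_of_real ((2 * pi) * (g v * heaviside (L v - X))))"
      by (intro Bochner_Integration.integral_cong refl) (simp add: mult_ac)
    then show ?thesis by (simp only: integral_complex_of_real)
  qed
  also have "\<dots> = of_real (2 * pi * (LINT v|M. g v * heaviside (L v - X)))"
    by (simp only: integral_mult_right_zero)
  finally have "((\<lambda>T. \<i> * (LINT v|M. of_real (g v) * perron_kernel c T (L v - X))) \<longlongrightarrow>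
     \<i> * of_real (2 * pi * (LINT v|M. g v * heaviside (L v - X)))) at_top"
    by (rule tendsto_mult_left)
  moreover have "\<forall>\<^sub>F T in at_top. \<i> * (LINT v|M. of_real (g v) * perron_kernel c T (L v - X)) =
     contour_integral (linepath (Complex c (- T)) (Complex c T)) f"
    using eventually_gt_at_top[of 0] by eventually_elim (simp add: contour_integral_unique[OF contour])
  ultimately have "((\<lambda>T. contour_integral (linepath (Complex c (- T)) (Complex c T)) f) \<longlongrightarrow>
     \<i> * of_real (2 * pi * (LINT v|M. g v * heaviside (L v - X)))) at_top"
    by (simp only: tendsto_cong)
  moreover have "f contour_integrable_on linepath (Complex c (- T)) (Complex c T)" if "T > 0" for T
    using contour[OF that] by (auto simp: contour_integrable_on_def)
  ultimately show ?thesis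
    unfolding has_vertical_integral_def by (simp add: mult_ac)
qed

lemma vertical_integral_eq:
  assumes "has_vertical_integral f c I"
  shows "vertical_integral c f = I"
  unfolding vertical_integral_def
proof (rule the_equality[where P = "has_vertical_integral f c", OF assms])
  fix I' assume "has_vertical_integral f c I'"
  with assms show "I' = I"
    unfolding has_vertical_integral_def using tendsto_unique[OF trivial_limit_at_top_linorder] by blast
qed

section \<open>The one-level density\<close>

theorem theorem2:
  fixes N :: nat and X \<theta> c :: real
  assumes "N \<ge> 1"
    and "excised_mass N X \<noteq> 0"
    and "0 < \<theta>" and "\<theta> < pi"
    and "c > 0"
  shows "vertical_integrable (density_integrand N X \<theta>) c \<and>
         complex_of_real (one_level_density N X \<theta>) =
           complex_of_real (excised_const N X) / (2 * of_real pi * \<i>) *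
           vertical_integral c (density_integrand N X \<theta>)"
proof -
  obtain n where N: "N = Suc n" using assms(1) by (cases N) auto
  interpret product_sigma_finite "\<lambda>_::nat. lborel :: real measure"
    by standard
  define M where "M = (\<Pi>\<^sub>M j\<in>{2..N}. (lborel :: real measure))"
  define S where "S = (\<Pi>\<^sub>E j\<in>{2..N}. {0..pi})"
  define \<Lambda> where "\<Lambda> v = char_poly_at_one N (v(1 := \<theta>))" for v
  define V where "V v = (\<Prod>k\<in>{1..N}. \<Prod>j\<in>{1..<k}. (cos ((v(1 := \<theta>)) j) - cos ((v(1 := \<theta>)) k))\<^sup>2)" for v
  \<comment> \<open>Setting \<open>g\<close> to 0 where \<open>\<Lambda>\<close> vanishes hides the
    conventional value \<open>ln 0 = 0\<close> in \<open>L\<close>, in accordance with the case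
    distinction in \<open>excised_weight\<close>.\<close>
  define g where "g v = real N * (indicator S v * (if \<Lambda> v = 0 then 0 else V v))" for v
  define L where "L v = ln (\<Lambda> v)" for v
  have sigma: "sigma_finite_measure M" unfolding M_def by (rule sigma_finite) simp
  have S[measurable]: "S \<in> sets M"
    unfolding S_def M_def by (rule sets_PiM_I_finite) auto
  have S_fin: "emeasure M S < \<infinity>"
  proof -
    have "emeasure M S = (\<Prod>j\<in>{2..N}. emeasure lborel {0..pi})"
      unfolding S_def M_def by (rule emeasure_PiM) auto
    also have "\<dots> < \<infinity>" by (simp add: power_less_top_ennreal)
    finally show ?thesis .
  qed
  have comp: "(\<lambda>v. (v(1 := \<theta>)) j) \<in> borel_measurable M" if "j \<in> {1..N}" for j
  proof (cases "j = 1")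
    case False
    then have "(\<lambda>v. v j) \<in> measurable M lborel"
      unfolding M_def using that by (intro measurable_component_singleton) auto
    then show ?thesis using False by (simp add: measurable_lborel1)
  qed simp
  have cos_comp: "(\<lambda>v. cos ((v(1 := \<theta>)) j)) \<in> borel_measurable M" if "j \<in> {1..N}" for j
    by (rule measurable_compose[OF comp[OF that] borel_measurable_cos])
  have \<Lambda>_m[measurable]: "\<Lambda> \<in> borel_measurable M"
    unfolding \<Lambda>_def[abs_def] char_poly_at_one_def
    by (intro borel_measurable_times borel_measurable_const borel_measurable_prod borel_measurable_diff cos_comp)
  have V_m[measurable]: "V \<in> borel_measurable M"
    unfolding V_def[abs_def]
    by (intro borel_measurable_prod borel_measurable_power borel_measurable_diff cos_comp) auto
  have L_m: "L \<in> borel_measurable M" unfolding L_def[abs_def] by measurable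
  have g_m[measurable]: "g \<in> borel_measurable M" unfolding g_def[abs_def] by measurable
  \<comment> \<open>This gives the upper bound on \<open>L\<close>: one \<open>2 ^ N\<close> is the
    prefactor, the other bounds the \<open>N\<close> factors \<open>1 - cos\<close>.\<close>
  have \<Lambda>_nonneg: "\<Lambda> v \<ge> 0" and \<Lambda>_le: "\<Lambda> v \<le> 2 ^ N * 2 ^ N" for v
  proof -
    have f: "0 \<le> 1 - cos y" "1 - cos y \<le> 2" for y :: real
      using cos_le_one[of y] cos_ge_minus_one[of y] by linarith+
    show "\<Lambda> v \<ge> 0" unfolding \<Lambda>_def char_poly_at_one_def by (intro mult_nonneg_nonneg prod_nonneg) (auto simp: f)
    have "(\<Prod>j\<in>{1..N}. 1 - cos ((v(1 := \<theta>)) j)) \<le> (\<Prod>j\<in>{1..N}. 2)"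
      by (intro prod_mono) (simp add: f del: fun_upd_apply)
    then show "\<Lambda> v \<le> 2 ^ N * 2 ^ N" unfolding \<Lambda>_def char_poly_at_one_def by simp
  qed
  define K where "K = (\<Prod>k\<in>{1..N}. \<Prod>j\<in>{1..<k}. (4::real))"
  have V_bound: "0 \<le> V v" "V v \<le> K" for v
  proof -
    have sq: "(cos x - cos y)\<^sup>2 \<le> 4" for x y :: real
    proof -
      have "\<bar>cos x - cos y\<bar> \<le> 2"
        using cos_le_one[of x] cos_ge_minus_one[of x] cos_le_one[of y] cos_ge_minus_one[of y] by linarith
      then have "\<bar>cos x - cos y\<bar>\<^sup>2 \<le> 2\<^sup>2" by (intro power_mono) auto
      then show ?thesis by simp
    qed
    show "0 \<le> V v" unfolding V_def by (intro prod_nonneg) auto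
    show "V v \<le> K" unfolding V_def K_def by (intro prod_mono conjI prod_nonneg ballI sq zero_le_power2)
  qed
  have g_int: "integrable M g"
  proof (rule Bochner_Integration.integrable_bound)
    show "integrable M (\<lambda>v. (real N * K) * indicator S v)"
      using S_fin by (intro integrable_mult_right integrable_real_indicator S)
    have "norm (g v) \<le> norm ((real N * K) * indicator S v)" for v
      using V_bound[of v] by (auto simp: g_def indicator_def abs_mult intro!: mult_left_mono)
    then show "AE v in M. norm (g v) \<le> norm ((real N * K) * indicator S v)" by simp
  qed measurable
  have LB: "L v \<le> ln (2 ^ N * 2 ^ N)" if "g v \<noteq> 0" for v
  proof -
    have "\<Lambda> v \<noteq> 0" using that by (auto simp: g_def)
    then have "\<Lambda> v > 0" using \<Lambda>_nonneg[of v] by simp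
    then show ?thesis unfolding L_def by (intro ln_mono \<Lambda>_le) auto
  qed
  have f_eq: "density_integrand N X \<theta> r = exp (- r * of_real X) / r * (LINT v|M. of_real (g v) * exp (r * of_real (L v)))"
    if "Re r = c" for r
  proof -
    have r: "Re r > 0" using that assms(5) by simp
    define J where "J = jacobi_wronskian N r \<theta>"
    define Q where "Q = (\<Prod>j\<in>{0..<N}. Gamma (2 + of_nat j) * Gamma (1 / 2 + of_nat j) * Gamma (r + 1 / 2 + of_nat j)
                     / Gamma (r + of_nat N + of_nat j))"
    define Y where "Y = Gamma (of_nat N + 1) * Gamma (of_nat N + r) / (Gamma (of_nat N + r - 1 / 2) * Gamma (of_nat N - 1 / 2))"
    \<comment> \<open>Where \<open>\<Lambda> v = 0\<close> the left side vanishes through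
      \<open>g\<close> and the right side through \<open>0 powr r = 0\<close>.\<close>
    have "of_real (g v) * exp (r * of_real (L v)) = of_nat N * (indicator S v *\<^sub>R (of_real (V v) * of_real (\<Lambda> v) powr r))" for v
    proof (cases "\<Lambda> v = 0")
      case False
      then have "complex_of_real (\<Lambda> v) powr r = exp (r * of_real (L v))"
        using \<Lambda>_nonneg[of v] by (simp add: powr_def L_def Ln_of_real)
      then show ?thesis using False by (simp add: g_def indicator_def)
    qed (simp add: g_def)
    then have "(LINT v|M. of_real (g v) * exp (r * of_real (L v))) =
      of_nat N * (LINT v|M. indicator S v *\<^sub>R (of_real (V v) * of_real (\<Lambda> v) powr r))"
      by (simp only: integral_mult_right_zero)
    also have "(LINT v|M. indicator S v *\<^sub>R (of_real (V v) * of_real (\<Lambda> v) powr r)) =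
      fact n * (\<Prod>j<N. jacobi_norm r j) * (\<Sum>j\<le>n. poly (monic_jacobi r j) (of_real (cos \<theta>)) ^ 2 / jacobi_norm r j) *
      2 powr (of_nat N * r) * complex_of_real (1 - cos \<theta>) powr r"
      unfolding M_def S_def V_def \<Lambda>_def N by (rule integral_eigenangles[OF r])
    also have "of_nat N * (fact n * (\<Prod>j<N. jacobi_norm r j) * (\<Sum>j\<le>n. poly (monic_jacobi r j) (of_real (cos \<theta>)) ^ 2 / jacobi_norm r j) *
      2 powr (of_nat N * r) * complex_of_real (1 - cos \<theta>) powr r) =
      (fact N * (\<Prod>j<N. jacobi_norm r j)) * (\<Sum>j\<le>n. poly (monic_jacobi r j) (of_real (cos \<theta>)) ^ 2 / jacobi_norm r j) *
      2 powr (of_nat N * r) * complex_of_real (1 - cos \<theta>) powr r"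
      unfolding N fact_Suc by (simp only: mult_ac)
    also have "fact N * (\<Prod>j<N. jacobi_norm r j) = 2 powr (of_nat N * r + of_nat (N\<^sup>2) - of_nat N) * Q"
      unfolding Q_def by (rule fact_mult_prod_jacobi_norm[OF r])
    also have "(\<Sum>j\<le>n. poly (monic_jacobi r j) (of_real (cos \<theta>)) ^ 2 / jacobi_norm r j) =
      2 powr (1 - r) / (2 * of_nat N + r - 1) * Y * J"
      unfolding Y_def J_def N by (rule jacobi_kernel_eq[OF r])
    finally have I: "(LINT v|M. of_real (g v) * exp (r * of_real (L v))) =
      2 powr (of_nat N * r + of_nat (N\<^sup>2) - of_nat N) * Q * (2 powr (1 - r) / (2 * of_nat N + r - 1) * Y * J) *
      2 powr (of_nat N * r) * complex_of_real (1 - cos \<theta>) powr r" .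
    \<comment> \<open>The term \<open>2 N r\<close> in the exponent has two sources: the norms, and
      the factor \<open>2 ^ N\<close> in the characteristic polynomial raised to the power
      \<open>r\<close>.\<close>
    have "2 powr (of_nat (N\<^sup>2) + 2 * of_nat N * r - of_nat N) =
      (2 powr (of_nat N * r + of_nat (N\<^sup>2) - of_nat N) * 2 powr (of_nat N * r) :: complex)"
      by (simp add: algebra_simps flip: powr_add)
    then show ?thesis
      unfolding I density_integrand_def J_def[symmetric] Q_def[symmetric] Y_def[symmetric] by (simp only: mult_ac)
  qed
  define I where "I = (LINT v|M. g v * heaviside (L v - X))"
  have vert: "has_vertical_integral (density_integrand N X \<theta>) c (2 * of_real pi * \<i> * of_real I)"
    unfolding I_def by (rule has_vertical_integral_Mellin_transform[OF sigma g_int L_m LB assms(5) f_eq])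
  have "one_level_density N X \<theta> = excised_const N X * I"
  proof -
    have "g v * heaviside (L v - X) = real N * (indicator S v *\<^sub>R excised_weight N X (v(1 := \<theta>)))" for v
    proof -
      have "excised_weight N X (v(1 := \<theta>)) = (if \<Lambda> v = 0 then 0 else heaviside (ln \<bar>\<Lambda> v\<bar> - X)) * V v"
        unfolding excised_weight_def \<Lambda>_def V_def ..
      then show ?thesis using \<Lambda>_nonneg[of v] by (simp add: g_def L_def)
    qed
    then have "I = real N * (LINT v:S|M. excised_weight N X (v(1 := \<theta>)))"
      unfolding I_def set_lebesgue_integral_def by (simp only: integral_mult_right_zero)
    then show ?thesis
      unfolding one_level_density_def M_def S_def by (simp only: mult.assoc)
  qed
  moreover have "vertical_integrable (density_integrand N X \<theta>) c"
    using vert unfolding vertical_integrable_def by blast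
  ultimately show ?thesis
    using vertical_integral_eq[OF vert] by (simp add: field_simps)
qed

end
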